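(* For $m\ge1$: (a) if $n\ge3$, each of $h_m[\ell_n],h_m[\pi_n],e_m[\ell_n],e_m[\pi_n]$ is bounded by $m(n-1)$; (b) $h_m[\ell_2]$ is sharply bounded by $m$; (c) $e_m[\pi_2]$ is sharply bounded by $m+1$; (d) if $\lambda$ has no part equal to $1$ and $\mathrm{rank}(\lambda)=i$, then $\mathrm{Lie}_\lambda$ is bounded by $i$ and $W_\lambda$ is bounded by $i+1$; (e) for $i\ge1$, writing $\bigoplus_{m}\widehat{\mathrm{Lie}}^i_m=\sum_\mu c_\mu\chi^\mu$ one has $\max\{|\mu|+\mu_1:c_\mu\ne0\}=3i$, and writing $\bigoplus_m\widehat W^i_m=\sum_\mu c_\mu\chi^\mu$ one has $\max\{|\mu|+\mu_1:c_\mu\ne0\}=3i+1$.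
   Context: Let $C_n\subset S_n$ be generated by an $n$-cycle $c$, $\chi_\zeta$ a linear character of $C_n$ sending $c$ to a primitive $n$-th root of unity, $\mathrm{Lie}_{(n)}=\chi_\zeta\uparrow_{C_n}^{S_n}$, $\ell_n=\mathrm{ch}(\mathrm{Lie}_{(n)})$ (Frobenius characteristic), $\pi_n=\omega(\ell_n)$; $f[g]$ is plethysm. For $\lambda=1^{m_1}2^{m_2}\cdots$, $\mathrm{ch}(\mathrm{Lie}_\lambda)=\prod_j h_{m_j}[\ell_j]$, $\mathrm{ch}(W_\lambda)=\prod_{j\text{ odd}}h_{m_j}[\pi_j]\prod_{j\text{ even}}e_{m_j}[\pi_j]$; $\mathrm{rank}(\lambda)=|\lambda|-\ell(\lambda)$. $\widehat{\mathrm{Lie}}^i_m=\bigoplus\mathrm{Lie}_\lambda$ and $\widehat W^i_m=\bigoplus W_\lambda$ over partitions $\lambda$ of $m$ with no part $1$ and rank $i$. A symmetric function or character $\sum_\lambda c_\lambda s_\lambda$ (resp. $\sum c_\lambda\chi^\lambda$) is bounded by $N$ if $c_\lambda\ne0$ implies $\lambda_1\le N$, and sharply bounded by $N$ if $N$ is the smallest such number. *)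

theory Defs
  imports Complex_Main "HOL-Library.Multiset" "HOL-Combinatorics.Permutations"
begin

text \<open>Symmetric functions over the complex numbers, represented by their
coefficients in the power-sum basis: a partition is a multiset of positive
naturals, and f :: sf assigns to each partition mu the coefficient of p_mu.\<close>

type_synonym sf = "nat multiset \<Rightarrow> complex"

definition is_part :: "nat multiset \<Rightarrow> bool" where
  "is_part lam \<longleftrightarrow> 0 \<notin># lam"

definition psize :: "nat multiset \<Rightarrow> nat" where
  "psize lam = sum_mset lam"

definition plen :: "nat multiset \<Rightarrow> nat" where
  "plen lam = size lam"

definition part1 :: "nat multiset \<Rightarrow> nat" where
  "part1 lam = (if lam = {#} then 0 else Max_mset lam)"

definition rank :: "nat multiset \<Rightarrow> nat" where
  "rank lam = psize lam - plen lam"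

definition zee :: "nat multiset \<Rightarrow> nat" where
  "zee lam = (\<Prod>i\<in>set_mset lam. i ^ count lam i * fact (count lam i))"

definition sf_zero :: sf where "sf_zero = (\<lambda>_. 0)"
definition sf_one :: sf where "sf_one = (\<lambda>mu. if mu = {#} then 1 else 0)"
definition sf_add :: "sf \<Rightarrow> sf \<Rightarrow> sf" where "sf_add f g = (\<lambda>mu. f mu + g mu)"
definition sf_scale :: "complex \<Rightarrow> sf \<Rightarrow> sf" where "sf_scale c f = (\<lambda>mu. c * f mu)"

definition sf_p :: "nat multiset \<Rightarrow> sf" where
  "sf_p lam = (\<lambda>mu. if mu = lam then 1 else 0)"

text \<open>product: p_nu * p_rho = p_(nu + rho)\<close>
definition sf_mult :: "sf \<Rightarrow> sf \<Rightarrow> sf" where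
  "sf_mult f g = (\<lambda>mu. \<Sum>nu\<in>{nu. nu \<subseteq># mu}. f nu * g (mu - nu))"

definition sf_prod_list :: "sf list \<Rightarrow> sf" where
  "sf_prod_list fs = foldr sf_mult fs sf_one"

definition sf_sum :: "('a \<Rightarrow> sf) \<Rightarrow> 'a set \<Rightarrow> sf" where
  "sf_sum F A = (\<lambda>mu. \<Sum>a\<in>A. F a mu)"

definition sf_prod :: "('a \<Rightarrow> sf) \<Rightarrow> 'a set \<Rightarrow> sf" where
  "sf_prod F A = sf_prod_list (map F (SOME xs. set xs = A \<and> distinct xs))"

definition sf_h :: "nat \<Rightarrow> sf" where
  "sf_h m = (\<lambda>mu. if is_part mu \<and> psize mu = m then 1 / of_nat (zee mu) else 0)"

definition sf_e :: "nat \<Rightarrow> sf" where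
  "sf_e m = (\<lambda>mu. if is_part mu \<and> psize mu = m
                   then (-1) ^ (psize mu - plen mu) / of_nat (zee mu) else 0)"

definition sf_omega :: "sf \<Rightarrow> sf" where
  "sf_omega f = (\<lambda>mu. (-1) ^ (psize mu - plen mu) * f mu)"

text \<open>plethysm: p_k[g] replaces every p_j by p_(jk); f[g] = sum_lambda f_lambda prod_i p_(lambda_i)[g]\<close>
definition pk_pleth :: "nat \<Rightarrow> sf \<Rightarrow> sf" where
  "pk_pleth k g = (\<lambda>mu. if (\<forall>x\<in>#mu. k dvd x) then g (image_mset (\<lambda>x. x div k) mu) else 0)"

definition pleth :: "sf \<Rightarrow> sf \<Rightarrow> sf" where
  "pleth f g = sf_sum (\<lambda>lam. sf_scale (f lam)
        (sf_prod_list (map (\<lambda>k. pk_pleth k g) (sorted_list_of_multiset lam))))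
     {lam. f lam \<noteq> 0}"

text \<open>Frobenius characteristic of Lie_(n) = Ind_{C_n}^{S_n} chi_zeta, computed by
 ch(Ind_H^{S_n} phi) = (1/|H|) sum_{h in H} phi(h) p_{type(h)}; here H = <c>, c^k has
 cycle type ((n / gcd(k,n))^{gcd(k,n)}) and chi_zeta(c^k) = zeta^k, zeta = exp(2 pi i / n).\<close>
definition lie_ell :: "nat \<Rightarrow> sf" where
  "lie_ell n = sf_scale (1 / of_nat n)
     (sf_sum (\<lambda>k. sf_scale (cis (2 * pi / real n) ^ k)
                    (sf_p (replicate_mset (gcd k n) (n div gcd k n)))) {..<n})"

definition lie_pi :: "nat \<Rightarrow> sf" where
  "lie_pi n = sf_omega (lie_ell n)"

definition chLie :: "nat multiset \<Rightarrow> sf" where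
  "chLie lam = sf_prod (\<lambda>j. pleth (sf_h (count lam j)) (lie_ell j)) (set_mset lam)"

definition chW :: "nat multiset \<Rightarrow> sf" where
  "chW lam = sf_prod (\<lambda>j. if odd j then pleth (sf_h (count lam j)) (lie_pi j)
                          else pleth (sf_e (count lam j)) (lie_pi j)) (set_mset lam)"

text \<open>Schur functions via the Jacobi-Trudi identity s_lambda = det(h_{lambda_i - i + j})\<close>
definition sf_hz :: "int \<Rightarrow> sf" where
  "sf_hz j = (if j < 0 then sf_zero else sf_h (nat j))"

definition schur :: "nat multiset \<Rightarrow> sf" where
  "schur lam = (let xs = rev (sorted_list_of_multiset lam); k = length xs in
     sf_sum (\<lambda>\<sigma>. sf_scale (of_int (sign \<sigma>))
        (sf_prod_list (map (\<lambda>i. sf_hz (int (xs ! i) - int i + int (\<sigma> i))) [0..<k])))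
       {\<sigma>. \<sigma> permutes {0..<k}})"

text \<open>Hall inner product <p_lambda, p_mu> = z_lambda delta; the coefficient of s_lambda
 in f is <f, s_lambda> since the Schur functions are orthonormal.\<close>
definition schur_coeff :: "sf \<Rightarrow> nat multiset \<Rightarrow> complex" where
  "schur_coeff f lam = (\<Sum>mu\<in>{mu. f mu \<noteq> 0}. of_nat (zee mu) * f mu * schur lam mu)"

definition bounded_by :: "sf \<Rightarrow> nat \<Rightarrow> bool" where
  "bounded_by f N \<longleftrightarrow> (\<forall>lam. is_part lam \<and> schur_coeff f lam \<noteq> 0 \<longrightarrow> part1 lam \<le> N)"

definition sharply_bounded_by :: "sf \<Rightarrow> nat \<Rightarrow> bool" where
  "sharply_bounded_by f N \<longleftrightarrow> bounded_by f N \<and> (\<forall>M. bounded_by f M \<longrightarrow> N \<le> M)"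

definition hat_parts :: "nat \<Rightarrow> nat multiset set" where
  "hat_parts i = {lam. is_part lam \<and> 1 \<notin># lam \<and> rank lam = i}"

definition hatLie :: "nat \<Rightarrow> sf" where
  "hatLie i = sf_sum chLie (hat_parts i)"

definition hatW :: "nat \<Rightarrow> sf" where
  "hatW i = sf_sum chW (hat_parts i)"

end

(* Let f[X + t] be obtained from f by the substitution p_k -> p_k + t^k. The coefficient of t^a in
   f[X + t] is the result of skewing f by h_a, so by the Jacobi-Trudi expansion along the first
   row f is bounded by N as soon as f[X + t] has degree at most N in t. For n > 1 the term t^n
   cancels in l_n[X + t], the sum of the powers of a nontrivial n-th root of unity being zero,
   and the coefficient of t^(n-1) is p_1; hence f[l_n][X + t] has degree at most m(n-1) for f of
   degree m, with coefficient f at t^(m(n-1)). The same holds for pi_n when n > 2. For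
   pi_2 = h_2 the term t^2 survives, but it is a single new variable and occurs at most once in
   e_m, so e_m[pi_2] has degree m + 1 with top coefficient e_(m-1). The shapes (m, m) and
   (m+1, 1^(m-1)) witness sharpness: only the identity permutation contributes to their
   Jacobi-Trudi expansion. *)

theory Submission
  imports Defs "HOL-Library.Poly_Mapping" "HOL-Computational_Algebra.Polynomial"
begin

section \<open>Homogeneous symmetric functions\<close>

text \<open>An \<open>sf\<close> may have infinite support, where a sum over the support collapses
  to 0; homogeneity is therefore tracked throughout, and the finitely many partitions of the degree
  serve as index set. f[X + t] is a polynomial in t over the algebra of finitely supported functions
  on multisets, with p_mu as the basis element mu. Power sums make plethysm a substitution but leave
  Jacobi-Trudi as the only access to Schur coefficients, so everything is phrased through Hall
  pairings of f with products of complete functions. For the maximum of |mu| + mu_1 the two summands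
  are bounded separately. Without parts 1, a partition of rank i has at most i parts, so its size is
  at most 2i, with equality only for 2^i; and mu_1 is at most i, or i + 1, by the degree bound. In
  size 2i the sum over partitions reduces to the single term h_i[l_2] or e_i[pi_2], and the sharp
  shapes have exactly this size.\<close>

definition parts :: "nat \<Rightarrow> nat multiset set" where
  "parts n = {mu. is_part mu \<and> psize mu = n}"

definition homog :: "nat \<Rightarrow> sf \<Rightarrow> bool" where
  "homog n f \<longleftrightarrow> (\<forall>mu. f mu \<noteq> 0 \<longrightarrow> mu \<in> parts n)"

lemma size_le_psize: "is_part mu \<Longrightarrow> size mu \<le> psize mu"
proof (induction mu)
  case (add x mu)
  then show ?case by (cases x) (auto simp: is_part_def psize_def)
qed (simp add: psize_def)

lemma part_le_psize: "x \<in># mu \<Longrightarrow> x \<le> psize mu"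
  by (auto simp: psize_def dest: multi_member_split)

lemma finite_parts: "finite (parts n)"
proof (rule finite_subset)
  show "parts n \<subseteq> (\<Union>k\<le>n. multisets_of_size {..n} k)"
    using size_le_psize part_le_psize
    by (fastforce simp: parts_def multisets_of_size_def)
qed auto

lemma finite_submultisets: "finite {nu. nu \<subseteq># (mu :: 'a multiset)}"
proof (rule finite_subset)
  show "{nu. nu \<subseteq># mu} \<subseteq> (\<Union>k\<le>size mu. multisets_of_size (set_mset mu) k)"
    by (auto simp: multisets_of_size_def size_mset_mono dest: mset_subset_eqD)
qed auto

lemma homog_finite: "homog n f \<Longrightarrow> finite {mu. f mu \<noteq> 0}"
  by (rule finite_subset[OF _ finite_parts[of n]]) (auto simp: homog_def)

lemma homogD: "homog n f \<Longrightarrow> f mu \<noteq> 0 \<Longrightarrow> is_part mu \<and> psize mu = n"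
  by (auto simp: homog_def parts_def)

lemma parts_add_mset: "0 < k \<Longrightarrow> add_mset k mu \<in> parts n \<longleftrightarrow> k \<le> n \<and> mu \<in> parts (n - k)"
  by (auto simp: parts_def is_part_def psize_def)

lemma parts_union: "mu \<in> parts m \<Longrightarrow> nu \<in> parts n \<Longrightarrow> mu + nu \<in> parts (m + n)"
  by (auto simp: parts_def is_part_def psize_def)

lemma homog_zero: "homog n sf_zero"
  by (simp add: homog_def sf_zero_def)

lemma homog_one: "homog 0 sf_one"
  by (simp add: homog_def sf_one_def parts_def is_part_def psize_def)

lemma homog_p: "mu \<in> parts n \<Longrightarrow> homog n (sf_p mu)"
  by (simp add: homog_def sf_p_def)

lemma homog_h: "homog n (sf_h n)"
  by (simp add: homog_def sf_h_def parts_def)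

lemma homog_e: "homog n (sf_e n)"
  by (simp add: homog_def sf_e_def parts_def)

lemma homog_scale: "homog n f \<Longrightarrow> homog n (sf_scale c f)"
  by (simp add: homog_def sf_scale_def)

lemma homog_sum:
  assumes "\<And>a. a \<in> A \<Longrightarrow> homog n (F a)"
  shows "homog n (sf_sum F A)"
  unfolding homog_def
proof safe
  fix mu assume "sf_sum F A mu \<noteq> 0"
  then obtain a where "a \<in> A" "F a mu \<noteq> 0"
    unfolding sf_sum_def using sum.neutral[of A "\<lambda>a. F a mu"] by blast
  then show "mu \<in> parts n" using assms by (auto simp: homog_def)
qed

lemma homog_mult:
  assumes "homog m f" "homog n g"
  shows "homog (m + n) (sf_mult f g)"
  unfolding homog_def
proof safe
  fix mu assume "sf_mult f g mu \<noteq> 0"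
  then obtain nu where "nu \<subseteq># mu" "f nu * g (mu - nu) \<noteq> 0"
    unfolding sf_mult_def using sum.neutral[of "{nu. nu \<subseteq># mu}" "\<lambda>nu. f nu * g (mu - nu)"] by blast
  then show "mu \<in> parts (m + n)"
    using assms parts_union[of nu m "mu - nu" n] by (auto simp: homog_def)
qed

lemma homog_prod_list:
  assumes "\<And>x. x \<in> set xs \<Longrightarrow> homog (d x) (F x)"
  shows "homog (sum_list (map d xs)) (sf_prod_list (map F xs))"
  using assms by (induction xs) (auto simp: sf_prod_list_def homog_one intro: homog_mult)

lemma sum_mset_div:
  assumes "\<forall>x\<in>#mu. (k :: nat) dvd x"
  shows "k * sum_mset (image_mset (\<lambda>x. x div k) mu) = sum_mset mu"
  using assms by (induction mu) (auto simp: algebra_simps)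

lemma homog_pk_pleth:
  assumes "homog n g"
  shows "homog (k * n) (pk_pleth k g)"
  unfolding homog_def
proof safe
  fix mu assume "pk_pleth k g mu \<noteq> 0"
  then have d: "\<forall>x\<in>#mu. k dvd x" and g: "g (image_mset (\<lambda>x. x div k) mu) \<noteq> 0"
    by (auto simp: pk_pleth_def split: if_splits)
  with assms have "image_mset (\<lambda>x. x div k) mu \<in> parts n" by (auto simp: homog_def)
  with sum_mset_div[OF d] show "mu \<in> parts (k * n)"
    by (force simp: parts_def psize_def is_part_def)
qed

lemma homog_pleth:
  assumes "homog m f" "homog n g"
  shows "homog (m * n) (pleth f g)"
  unfolding pleth_def
proof (intro homog_sum homog_scale)
  fix mu assume "mu \<in> {mu. f mu \<noteq> 0}"
  then have "psize mu = m" using homogD[OF assms(1)] by auto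
  then have "m = sum_list (sorted_list_of_multiset mu)"
    unfolding psize_def by (metis mset_sorted_list_of_multiset sum_mset_sum_list)
  then have "m * n = sum_list (map (\<lambda>k. k * n) (sorted_list_of_multiset mu))"
    by (simp add: sum_list_mult_const)
  then show "homog (m * n) (sf_prod_list (map (\<lambda>k. pk_pleth k g) (sorted_list_of_multiset mu)))"
    using homog_prod_list[of "sorted_list_of_multiset mu" "\<lambda>k. k * n" "\<lambda>k. pk_pleth k g"]
      homog_pk_pleth[OF assms(2)] by simp
qed

section \<open>Evaluation of power sums\<close>

abbreviation cst :: "complex \<Rightarrow> nat multiset \<Rightarrow>\<^sub>0 complex" where
  "cst \<equiv> Poly_Mapping.single {#}"

abbreviation psum :: "nat \<Rightarrow> nat multiset \<Rightarrow>\<^sub>0 complex" where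
  "psum k \<equiv> Poly_Mapping.single {#k#} 1"

type_synonym spoly = "(nat multiset \<Rightarrow>\<^sub>0 complex) poly"

text \<open>The specialisation p_k -> \<open>x k\<close>. It is additive and multiplicative on
  homogeneous functions, whose support is finite.\<close>

definition sf_eval :: "(nat \<Rightarrow> spoly) \<Rightarrow> sf \<Rightarrow> spoly" where
  "sf_eval x f = (\<Sum>mu | f mu \<noteq> 0. smult (cst (f mu)) (\<Prod>k\<in>#mu. x k))"

text \<open>The power sums of the alphabet X + t.\<close>
definition shift :: "nat \<Rightarrow> spoly" where
  "shift k = [:psum k:] + monom 1 k"

lemma cst_mult: "cst (a * b) = cst a * cst b"
  using mult_single[of "{#} :: nat multiset" a "{#}" b] by simp

lemma cst_sum: "cst (sum f A) = (\<Sum>a\<in>A. cst (f a))"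
  by (induction A rule: infinite_finite_induct) (simp_all add: single_add)

lemma cst_1: "cst 1 = 1"
  by (metis single_one)

lemma smult_sum_left: "smult (sum f A) p = (\<Sum>a\<in>A. smult (f a) p)"
  by (induction A rule: infinite_finite_induct) (simp_all add: smult_add_left)

lemma smult_sum_right: "smult c (sum f A) = (\<Sum>a\<in>A. smult c (f a))"
  by (induction A rule: infinite_finite_induct) (simp_all add: smult_add_right)

lemma sf_eval_superset:
  assumes "finite S" "\<And>mu. f mu \<noteq> 0 \<Longrightarrow> mu \<in> S"
  shows "sf_eval x f = (\<Sum>mu\<in>S. smult (cst (f mu)) (\<Prod>k\<in>#mu. x k))"
  unfolding sf_eval_def using assms by (intro sum.mono_neutral_left) auto

lemma sf_eval_homog:
  "homog n f \<Longrightarrow> sf_eval x f = (\<Sum>mu\<in>parts n. smult (cst (f mu)) (\<Prod>k\<in>#mu. x k))"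
  by (rule sf_eval_superset) (auto simp: finite_parts homog_def)

lemma sf_eval_one: "sf_eval x sf_one = 1"
proof -
  have "{mu. sf_one mu \<noteq> 0} = {{#}}" by (auto simp: sf_one_def)
  then show ?thesis by (simp add: sf_eval_def sf_one_def cst_1)
qed

lemma sf_eval_p: "sf_eval x (sf_p mu) = (\<Prod>k\<in>#mu. x k)"
proof -
  have "{nu. sf_p mu nu \<noteq> 0} = {mu}" by (auto simp: sf_p_def)
  then show ?thesis by (simp add: sf_eval_def sf_p_def cst_1)
qed

lemma sf_eval_scale: "sf_eval x (sf_scale c f) = smult (cst c) (sf_eval x f)"
proof (cases "c = 0")
  case False
  then show ?thesis
    by (simp add: sf_eval_def sf_scale_def cst_mult smult_sum_right)
qed (simp add: sf_eval_def sf_scale_def)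

lemma sf_eval_sum:
  assumes "\<And>a. a \<in> A \<Longrightarrow> homog n (F a)"
  shows "sf_eval x (sf_sum F A) = (\<Sum>a\<in>A. sf_eval x (F a))"
proof -
  have "sf_eval x (sf_sum F A) = (\<Sum>mu\<in>parts n. \<Sum>a\<in>A. smult (cst (F a mu)) (\<Prod>k\<in>#mu. x k))"
    by (subst sf_eval_homog[OF homog_sum, OF assms])
      (simp_all add: sf_sum_def cst_sum smult_sum_left)
  also have "\<dots> = (\<Sum>a\<in>A. \<Sum>mu\<in>parts n. smult (cst (F a mu)) (\<Prod>k\<in>#mu. x k))"
    by (rule sum.swap)
  also have "\<dots> = (\<Sum>a\<in>A. sf_eval x (F a))"
    by (intro sum.cong refl) (simp add: sf_eval_homog[OF assms])
  finally show ?thesis .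
qed

lemma sf_eval_mult:
  assumes f: "homog m f" and g: "homog n g"
  shows "sf_eval x (sf_mult f g) = sf_eval x f * sf_eval x g"
proof -
  let ?M = "\<lambda>mu. \<Prod>k\<in>#mu. x k"
  let ?S = "SIGMA mu:parts (m + n). {nu. nu \<subseteq># mu}"
  let ?T = "parts m \<times> parts n"
  have M: "?M nu * ?M (mu - nu) = ?M mu" if "nu \<subseteq># mu" for mu nu
    by (metis that image_mset_union prod_mset.union subset_mset.add_diff_inverse)
  have "sf_eval x (sf_mult f g)
      = (\<Sum>mu\<in>parts (m + n). \<Sum>nu | nu \<subseteq># mu. smult (cst (f nu * g (mu - nu))) (?M mu))"
    by (subst sf_eval_homog[OF homog_mult[OF f g]])
      (simp add: sf_mult_def cst_sum smult_sum_left)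
  also have "\<dots> = (\<Sum>(mu, nu)\<in>?S. smult (cst (f nu * g (mu - nu))) (?M mu))"
    by (subst sum.Sigma) (auto simp: finite_parts finite_submultisets)
  \<comment> \<open>Pairs whose \<open>nu\<close> does not have size m have no partner in
    \<open>parts m \<times> parts n\<close>. Their terms vanish, so the bijection is only asked for
    on pairs with nonzero product.\<close>
  also have "\<dots> = (\<Sum>(nu, rho)\<in>?T. smult (cst (f nu * g rho)) (?M (nu + rho)))"
    using f g
    by (intro sum.reindex_bij_witness_not_neutral[where S' = "{(mu, nu) \<in> ?S. f nu * g (mu - nu) = 0}"
        and T' = "{(nu, rho) \<in> ?T. f nu * g rho = 0}"
        and i = "\<lambda>(nu, rho). (nu + rho, nu)" and j = "\<lambda>(mu, nu). (nu, mu - nu)"])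
      (auto simp: finite_parts finite_submultisets homog_def parts_union M
        intro: finite_subset[of _ ?S] finite_subset[of _ ?T])
  also have "\<dots> = sf_eval x f * sf_eval x g"
    by (simp add: sf_eval_homog[OF f] sf_eval_homog[OF g] sum_product sum.cartesian_product cst_mult
        mult_ac)
  finally show ?thesis .
qed

lemma sf_eval_prod_list:
  assumes "\<And>y. y \<in> set ys \<Longrightarrow> homog (d y) (F y)"
  shows "sf_eval x (sf_prod_list (map F ys)) = (\<Prod>y\<leftarrow>ys. sf_eval x (F y))"
  using assms
proof (induction ys)
  case (Cons y ys)
  then have "homog (sum_list (map d ys)) (sf_prod_list (map F ys))"
    by (intro homog_prod_list) auto
  with Cons sf_eval_mult[of "d y" "F y" _ "sf_prod_list (map F ys)" x] show ?case
    by (simp add: sf_prod_list_def)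
qed (simp add: sf_prod_list_def sf_eval_one)

text \<open>Plethysm replaces p_k by p_k[g], so its evaluation is that of \<open>f\<close> at other
  values of the power sums. Degrees of plethysms can thus be read off from the p_k[g] alone.\<close>

lemma sf_eval_pleth:
  assumes "homog m f" "homog n g"
  shows "sf_eval x (pleth f g) = sf_eval (\<lambda>k. sf_eval x (pk_pleth k g)) f"
proof -
  let ?P = "\<lambda>mu. sf_prod_list (map (\<lambda>k. pk_pleth k g) (sorted_list_of_multiset mu))"
  have hom: "homog (m * n) (sf_scale (f mu) (?P mu))" if "f mu \<noteq> 0" for mu
  proof -
    have "psize mu = m" using homogD[OF assms(1) that] by auto
    then have "m = sum_list (sorted_list_of_multiset mu)"
      unfolding psize_def by (metis mset_sorted_list_of_multiset sum_mset_sum_list)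
    then have "m * n = sum_list (map (\<lambda>k. k * n) (sorted_list_of_multiset mu))"
      by (simp add: sum_list_mult_const)
    then show ?thesis
      using homog_prod_list[of "sorted_list_of_multiset mu" "\<lambda>k. k * n" "\<lambda>k. pk_pleth k g"]
        homog_pk_pleth[OF assms(2)] by (simp add: homog_scale)
  qed
  have P: "sf_eval x (?P mu) = (\<Prod>k\<in>#mu. sf_eval x (pk_pleth k g))" for mu
  proof -
    have "sf_eval x (?P mu) = (\<Prod>k\<leftarrow>sorted_list_of_multiset mu. sf_eval x (pk_pleth k g))"
      using homog_pk_pleth[OF assms(2)] by (intro sf_eval_prod_list) auto
    also have "\<dots> = (\<Prod>k\<in>#mset (sorted_list_of_multiset mu). sf_eval x (pk_pleth k g))"
      by (simp only: mset_map[symmetric] prod_mset_prod_list)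
    finally show ?thesis by simp
  qed
  show ?thesis
    unfolding pleth_def
    by (subst sf_eval_sum[where n = "m * n"])
      (auto simp: hom sf_eval_scale P sf_eval_def[of _ f])
qed

section \<open>Skewing by complete homogeneous functions\<close>

text \<open>The Hall inner product, bilinear and without conjugation, in the form in which
  \<open>schur_coeff\<close> contains it.\<close>

definition sf_pair :: "sf \<Rightarrow> sf \<Rightarrow> complex" where
  "sf_pair f g = (\<Sum>mu | f mu \<noteq> 0. of_nat (zee mu) * f mu * g mu)"

definition sf_embed :: "sf \<Rightarrow> nat multiset \<Rightarrow>\<^sub>0 complex" where
  "sf_embed f = (\<Sum>mu | f mu \<noteq> 0. Poly_Mapping.single mu (f mu))"

lemma zee_superset:
  assumes "finite S" "set_mset mu \<subseteq> S"
  shows "zee mu = (\<Prod>i\<in>S. i ^ count mu i * fact (count mu i))"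
  unfolding zee_def using assms
  by (intro prod.mono_neutral_left) (auto simp: not_in_iff)

lemma zee_add_mset: "zee (add_mset k mu) = k * (count mu k + 1) * zee mu"
proof -
  let ?S = "insert k (set_mset mu)" and ?T = "set_mset mu - {k}"
  have S: "?S = insert k ?T" by auto
  have "zee (add_mset k mu) = (\<Prod>i\<in>?S. i ^ count (add_mset k mu) i * fact (count (add_mset k mu) i))"
    by (rule zee_superset) auto
  also have "\<dots> = (k ^ Suc (count mu k) * fact (Suc (count mu k)))
      * (\<Prod>i\<in>?T. i ^ count mu i * fact (count mu i))"
    by (subst S, subst prod.insert) (auto intro!: prod.cong)
  also have "\<dots> = k * (count mu k + 1)
      * ((k ^ count mu k * fact (count mu k)) * (\<Prod>i\<in>?T. i ^ count mu i * fact (count mu i)))"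
    by (simp add: algebra_simps)
  also have "(k ^ count mu k * fact (count mu k)) * (\<Prod>i\<in>?T. i ^ count mu i * fact (count mu i))
      = (\<Prod>i\<in>?S. i ^ count mu i * fact (count mu i))"
    by (subst S, subst prod.insert) auto
  also have "\<dots> = zee mu"
    by (rule zee_superset[symmetric]) auto
  finally show ?thesis .
qed

lemma zee_empty: "zee {#} = 1"
  by (simp add: zee_def)

lemma zee_pos: "is_part mu \<Longrightarrow> 0 < zee mu"
  by (induction mu) (auto simp: zee_empty zee_add_mset is_part_def)

text \<open>In coefficients, this says that k d/dp_k maps h_a to h_(a-k). The factor is the quotient
  of the two values of z.\<close>

lemma sf_h_add_mset:
  assumes "0 < k"
  shows "of_nat (k * (count nu k + 1)) * sf_h a (add_mset k nu)
    = (if k \<le> a then sf_h (a - k) nu else 0)"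
proof -
  have "(of_nat (k * (count nu k + 1)) :: complex) \<noteq> 0"
    using assms by (simp only: of_nat_eq_0_iff) simp
  then show ?thesis
    using assms by (auto simp: sf_h_def is_part_def psize_def zee_add_mset simp del: of_nat_add of_nat_Suc)
qed

lemma lookup_single_mult:
  "Poly_Mapping.lookup (Poly_Mapping.single kappa c * u) rho
    = (if kappa \<subseteq># rho then c * Poly_Mapping.lookup u (rho - kappa) else 0)"
proof -
  have "Poly_Mapping.lookup (Poly_Mapping.single kappa c * u) rho
      = c * Sum_any (\<lambda>q. Poly_Mapping.lookup u q when rho = kappa + q)"
    by (simp add: lookup_mult lookup_single when_mult)
  also have "Sum_any (\<lambda>q. Poly_Mapping.lookup u q when rho = kappa + q)
      = (if kappa \<subseteq># rho then Poly_Mapping.lookup u (rho - kappa) else 0)"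
  proof (cases "kappa \<subseteq># rho")
    case True
    then have "(\<lambda>q. Poly_Mapping.lookup u q when rho = kappa + q)
        = (\<lambda>q. Poly_Mapping.lookup u q when q = rho - kappa)"
      by (auto simp: when_def fun_eq_iff)
    then have "Sum_any (\<lambda>q. Poly_Mapping.lookup u q when rho = kappa + q)
        = Sum_any (\<lambda>q. Poly_Mapping.lookup u q when q = rho - kappa)"
      by (rule arg_cong)
    with True show ?thesis by simp
  next
    case False
    then have "(\<lambda>q. Poly_Mapping.lookup u q when rho = kappa + q) = (\<lambda>q. 0)"
      by (auto simp: when_def fun_eq_iff)
    then have "Sum_any (\<lambda>q. Poly_Mapping.lookup u q when rho = kappa + q) = 0"
      by (simp only: Sum_any.neutral)
    with False show ?thesis by simp
  qed
  finally show ?thesis by simp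
qed

lemma coeff_shift_mult:
  "coeff (shift k * p) a = psum k * coeff p a + (if k \<le> a then coeff p (a - k) else 0)"
  by (simp add: shift_def distrib_right coeff_monom_mult)

text \<open>For rho contained in mu this is the product over i of binomial(m_i(mu), m_i(rho)),
  restricted to rho of size |mu| - a.\<close>
lemma zee_lookup_coeff:
  assumes "is_part mu"
  shows "of_nat (zee rho) * Poly_Mapping.lookup (coeff (\<Prod>k\<in>#mu. shift k) a) rho
    = (if rho \<subseteq># mu then of_nat (zee mu) * sf_h a (mu - rho) else 0)"
  using assms
proof (induction mu arbitrary: rho a)
  case empty
  then show ?case
    by (auto simp: lookup_one when_def sf_h_def is_part_def psize_def zee_empty)
next
  case (add k mu)
  let ?L = "\<lambda>a. Poly_Mapping.lookup (coeff (\<Prod>k\<in>#mu. shift k) a)"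
  from add.prems have k: "0 < k" and mu: "is_part mu" by (auto simp: is_part_def)
  note IH = add.IH[OF mu]
  \<comment> \<open>The new factor contributes either p_k, and then \<open>rho\<close> contains k,
    or t^k.\<close>
  have L: "Poly_Mapping.lookup (coeff (\<Prod>k\<in>#add_mset k mu. shift k) a) rho
      = (if k \<in># rho then ?L a (rho - {#k#}) else 0) + (if k \<le> a then ?L (a - k) rho else 0)"
    by (simp add: coeff_shift_mult lookup_add lookup_single_mult)
  have 1: "of_nat (zee rho) * (if k \<in># rho then ?L a (rho - {#k#}) else 0)
      = (if k \<in># rho \<and> rho - {#k#} \<subseteq># mu
         then of_nat (k * count rho k) * (of_nat (zee mu) * sf_h a (mu - (rho - {#k#}))) else 0)"
  proof (cases "k \<in># rho")
    case True
    then obtain r where r: "rho = add_mset k r" by (metis insert_DiffM)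
    have "of_nat (zee rho) * ?L a r = of_nat (k * count rho k) * (of_nat (zee r) * ?L a r)"
      by (simp add: r zee_add_mset mult_ac)
    then show ?thesis
      using True unfolding IH by (simp add: r)
  qed simp
  have 2: "of_nat (zee rho) * (if k \<le> a then ?L (a - k) rho else 0)
      = (if rho \<subseteq># mu then of_nat (k * (count (mu - rho) k + 1)) *
          (of_nat (zee mu) * sf_h a (add_mset k (mu - rho))) else 0)"
    using IH[of rho "a - k"] sf_h_add_mset[OF k, of "mu - rho" a]
    by (auto simp: mult_ac simp del: of_nat_add of_nat_Suc of_nat_mult)
  show ?case
  proof (cases "rho \<subseteq># mu")
    case True
    then have sub: "rho \<subseteq># add_mset k mu" "rho - {#k#} \<subseteq># mu" "count rho k \<le> count mu k"
      by (auto simp: subseteq_mset_def le_diff_conv le_SucI)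
    have d: "add_mset k mu - rho = add_mset k (mu - rho)"
      using subset_mset.diff_add_assoc2[OF True, of "{#k#}"] by simp
    have d2: "mu - (rho - {#k#}) = add_mset k (mu - rho)" if "k \<in># rho"
    proof -
      from that obtain r where r: "rho = add_mset k r" by (metis insert_DiffM)
      show ?thesis
        using mset_subset_eq_count[OF True, of k] by (intro multiset_eqI) (auto simp: r)
    qed
    \<comment> \<open>The two choices carry the weights k m_k(rho) and k (m_k(mu - rho) + 1). Their
      sum k (m_k(mu) + 1) is the factor by which z grows when k joins \<open>mu\<close>.\<close>
    have c: "count rho k + (count (mu - rho) k + 1) = count mu k + 1"
      using sub(3) by simp
    have "of_nat (zee rho) * Poly_Mapping.lookup (coeff (\<Prod>k\<in>#add_mset k mu. shift k) a) rho
       = of_nat (k * count rho k + k * (count (mu - rho) k + 1)) *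
          (of_nat (zee mu) * sf_h a (add_mset k (mu - rho)))"
    proof (cases "k \<in># rho")
      case in_rho: True
      show ?thesis
        unfolding L distrib_left[of "of_nat (zee rho)"] 1 2
        by (simp only: in_rho True sub d2[OF in_rho] if_True simp_thms of_nat_add distrib_right)
    next
      case False
      then show ?thesis
        unfolding L distrib_left[of "of_nat (zee rho)"] 1 2 using True by (simp add: not_in_iff)
    qed
    also have "k * count rho k + k * (count (mu - rho) k + 1) = k * (count mu k + 1)"
      using c by (metis distrib_left)
    finally show ?thesis
      using sub d by (simp add: zee_add_mset mult_ac)
  next
    case False
    show ?thesis
    proof (cases "rho \<subseteq># add_mset k mu")
      case True
      have "k \<in># rho"
      proof (rule ccontr)
        assume "k \<notin># rho"
        then have "count rho x \<le> count mu x" for x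
          using mset_subset_eq_count[OF True, of x] by (cases "x = k") (auto simp: not_in_iff)
        with False show False by (simp add: subseteq_mset_def)
      qed
      then obtain r where r: "rho = add_mset k r" by (metis insert_DiffM)
      have "r \<subseteq># mu" using True r by simp
      \<comment> \<open>Here \<open>rho\<close> uses up every copy of k, so t^k cannot be chosen and
        the choice p_k alone supplies the whole factor k (m_k(mu) + 1).\<close>
      moreover have "count r k = count mu k"
      proof (rule ccontr)
        assume "count r k \<noteq> count mu k"
        moreover have "count r k \<le> count mu k" using \<open>r \<subseteq># mu\<close> by (simp add: mset_subset_eq_count)
        ultimately have "Suc (count r k) \<le> count mu k" by simp
        then have "rho \<subseteq># mu"
          using \<open>r \<subseteq># mu\<close> by (auto simp: r subseteq_mset_def)
        with False show False by simp
      qed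
      ultimately show ?thesis
        unfolding L distrib_left 1 2
        using True False by (simp add: r zee_add_mset mult_ac)
    next
      case notsub: False
      have "\<not> (k \<in># rho \<and> rho - {#k#} \<subseteq># mu)"
        using notsub by (metis insert_DiffM mset_subset_eq_add_mset_cancel)
      then show ?thesis
        unfolding L distrib_left 1 2 using False notsub by auto
    qed
  qed
qed

text \<open>Multiplication by h_a is adjoint to skewing by h_a: the right side is the Hall pairing
  of \<open>u a\<close> with \<open>g\<close>. Both sides expand over pairs
  \<open>rho \<subseteq># mu\<close>, and \<open>zee_lookup_coeff\<close> trades z_mu times a
  coefficient of h_a for z_rho times a coefficient of p_mu[X + t].\<close>

lemma sf_pair_h_mult:
  assumes f: "homog n f"
  defines "u a \<equiv> coeff (sf_eval shift f) a"
  shows "sf_pair f (sf_mult (sf_h a) g)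
    = (\<Sum>rho\<in>Poly_Mapping.keys (u a). of_nat (zee rho) * Poly_Mapping.lookup (u a) rho * g rho)"
proof -
  let ?S = "(\<Union>mu\<in>parts n. {rho. rho \<subseteq># mu}) \<union> Poly_Mapping.keys (u a)"
  let ?L = "\<lambda>mu. Poly_Mapping.lookup (coeff (\<Prod>k\<in>#mu. shift k) a)"
  have fin: "finite ?S" by (auto simp: finite_parts finite_submultisets)
  have conv: "sf_mult (sf_h a) g mu = (\<Sum>rho | rho \<subseteq># mu. sf_h a (mu - rho) * g rho)" for mu
  proof -
    have "mu - (mu - nu) = nu" if "nu \<subseteq># mu" for nu
      using that by (metis add_diff_cancel_right' subset_mset.add_diff_inverse)
    then show ?thesis
      unfolding sf_mult_def
      by (intro sum.reindex_bij_witness[of _ "\<lambda>nu. mu - nu" "\<lambda>nu. mu - nu"]) auto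
  qed
  have lookup_u: "Poly_Mapping.lookup (u a) rho = (\<Sum>mu\<in>parts n. f mu * ?L mu rho)" for rho
    by (simp add: u_def sf_eval_homog[OF f] coeff_sum lookup_sum lookup_single_mult)
  have summand: "of_nat (zee mu) * f mu * sf_mult (sf_h a) g mu
      = (\<Sum>rho\<in>?S. of_nat (zee rho) * g rho * (f mu * ?L mu rho))" if mu: "mu \<in> parts n" for mu
  proof -
    have "of_nat (zee mu) * f mu * sf_mult (sf_h a) g mu
        = (\<Sum>rho | rho \<subseteq># mu. f mu * g rho * (of_nat (zee mu) * sf_h a (mu - rho)))"
      by (simp add: conv sum_distrib_left mult_ac)
    also have "\<dots> = (\<Sum>rho\<in>?S. f mu * g rho * (if rho \<subseteq># mu then of_nat (zee mu) * sf_h a (mu - rho) else 0))"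
      using mu by (intro sum.mono_neutral_cong_left fin) auto
    also have "\<dots> = (\<Sum>rho\<in>?S. f mu * g rho * (of_nat (zee rho) * ?L mu rho))"
      using mu by (subst zee_lookup_coeff) (auto simp: parts_def)
    finally show ?thesis by (simp add: mult_ac)
  qed
  have "sf_pair f (sf_mult (sf_h a) g) = (\<Sum>mu\<in>parts n. of_nat (zee mu) * f mu * sf_mult (sf_h a) g mu)"
    unfolding sf_pair_def using f by (intro sum.mono_neutral_left finite_parts) (auto simp: homog_def)
  also have "\<dots> = (\<Sum>rho\<in>?S. \<Sum>mu\<in>parts n. of_nat (zee rho) * g rho * (f mu * ?L mu rho))"
    by (subst sum.swap) (intro sum.cong refl summand)
  also have "\<dots> = (\<Sum>rho\<in>?S. of_nat (zee rho) * Poly_Mapping.lookup (u a) rho * g rho)"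
    by (intro sum.cong refl, simp only: sum_distrib_left[symmetric] lookup_u) (simp only: mult_ac)
  also have "\<dots> = (\<Sum>rho\<in>Poly_Mapping.keys (u a). of_nat (zee rho) * Poly_Mapping.lookup (u a) rho * g rho)"
    by (rule sum.mono_neutral_right[OF fin Un_upper2]) (simp add: in_keys_iff)
  finally show ?thesis .
qed

lemma sf_pair_h_mult_eq_0:
  assumes "homog n f" "degree (sf_eval shift f) < a"
  shows "sf_pair f (sf_mult (sf_h a) g) = 0"
  using sf_pair_h_mult[OF assms(1), of a g] assms(2) by (simp add: coeff_eq_0)

lemma lookup_sf_embed:
  assumes "homog n f"
  shows "Poly_Mapping.lookup (sf_embed f) = f"
proof
  fix mu
  have "Poly_Mapping.lookup (sf_embed f) mu = (\<Sum>nu | f nu \<noteq> 0. if nu = mu then f nu else 0)"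
    by (simp add: sf_embed_def lookup_sum lookup_single when_def)
  then show "Poly_Mapping.lookup (sf_embed f) mu = f mu"
    using homog_finite[OF assms] by simp
qed

lemma sf_pair_h_mult_embed:
  assumes "homog n f" "homog m f'" "coeff (sf_eval shift f) a = sf_embed f'"
  shows "sf_pair f (sf_mult (sf_h a) g) = sf_pair f' g"
proof -
  have "Poly_Mapping.keys (sf_embed f') = {mu. f' mu \<noteq> 0}"
    by (auto simp: in_keys_iff lookup_sf_embed[OF assms(2)])
  then show ?thesis
    using sf_pair_h_mult[OF assms(1), of a g] lookup_sf_embed[OF assms(2)]
    by (simp add: assms(3) sf_pair_def)
qed

lemma sf_pair_sum_scale:
  "sf_pair f (sf_sum (\<lambda>s. sf_scale (c s) (G s)) A) = (\<Sum>s\<in>A. c s * sf_pair f (G s))"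
  unfolding sf_pair_def sf_sum_def sf_scale_def sum_distrib_left
  by (subst sum.swap) (simp add: mult_ac)

section \<open>Boundedness\<close>

abbreviation jt_term :: "nat list \<Rightarrow> (nat \<Rightarrow> nat) \<Rightarrow> nat \<Rightarrow> nat \<Rightarrow> sf" where
  "jt_term xs s a b \<equiv> sf_prod_list (map (\<lambda>i. sf_hz (int (xs ! i) - int i + int (s i))) [a..<b])"

lemma schur_coeff_eq:
  assumes "xs = rev (sorted_list_of_multiset lam)"
  shows "schur_coeff f lam = (\<Sum>s | s permutes {0..<length xs}.
    of_int (sign s) * sf_pair f (jt_term xs s 0 (length xs)))"
proof -
  have "schur lam = sf_sum (\<lambda>s. sf_scale (of_int (sign s)) (jt_term xs s 0 (length xs)))
      {s. s permutes {0..<length xs}}"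
    by (simp add: schur_def Let_def assms)
  then show ?thesis
    unfolding schur_coeff_def sf_pair_def[symmetric] by (simp only: sf_pair_sum_scale)
qed

text \<open>Counting from 0, the first row has the indices lambda_1 + s 0, all at least lambda_1.
  Once skewing by h_a kills f for every a \<ge> lambda_1, each term of the determinant pairs to
  zero, whatever its other rows are.\<close>

lemma jt_term_unroll:
  assumes "0 < k"
  shows "jt_term xs s 0 k = sf_mult (sf_h (xs ! 0 + s 0)) (jt_term xs s 1 k)"
proof -
  have "[0..<k] = 0 # [1..<k]" using assms by (simp add: upt_conv_Cons)
  then show ?thesis by (simp add: sf_prod_list_def sf_hz_def nat_add_distrib)
qed

lemma nth_0_rev_sorted:
  assumes "lam \<noteq> {#}"
  shows "rev (sorted_list_of_multiset lam) ! 0 = part1 lam"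
proof -
  define ys where "ys = sorted_list_of_multiset lam"
  have ne: "ys \<noteq> []" using assms
    by (metis ys_def mset.simps(1) mset_sorted_list_of_multiset)
  have "Max (set ys) = last ys"
  proof (rule Max_eqI)
    show "y \<le> last ys" if "y \<in> set ys" for y
      using that ne sorted_sorted_list_of_multiset[of lam]
      by (auto simp: in_set_conv_nth last_conv_nth sorted_iff_nth_mono simp flip: ys_def)
  qed (use ne in auto)
  then show ?thesis
    using assms ne by (simp add: part1_def rev_nth last_conv_nth flip: ys_def) (simp add: ys_def)
qed

lemma bounded_by_degree:
  assumes "homog n f" "degree (sf_eval shift f) \<le> N"
  shows "bounded_by f N"
  unfolding bounded_by_def
proof safe
  fix lam assume nz: "schur_coeff f lam \<noteq> 0"
  show "part1 lam \<le> N"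
  proof (rule ccontr)
    assume gt: "\<not> part1 lam \<le> N"
    \<comment> \<open>\<open>part1\<close> is 0 on the empty partition, so exceeding N guarantees a
      first row.\<close>
    then have ne: "lam \<noteq> {#}" by (auto simp: part1_def)
    define xs where "xs = rev (sorted_list_of_multiset lam)"
    have len: "0 < length xs"
      using ne unfolding xs_def by (metis length_greater_0_conv mset.simps(1) mset_rev mset_sorted_list_of_multiset)
    have "sf_pair f (jt_term xs s 0 (length xs)) = 0" for s
      using gt assms nth_0_rev_sorted[OF ne]
      unfolding jt_term_unroll[OF len] by (intro sf_pair_h_mult_eq_0) (auto simp: xs_def)
    then have "schur_coeff f lam = 0" by (simp add: schur_coeff_eq[OF xs_def])
    with nz show False ..
  qed
qed

section \<open>Top coefficients\<close>

lemma coeff_mult_top: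
  assumes "degree p \<le> a" "degree q \<le> b"
  shows "coeff (p * q) (a + b) = coeff p a * coeff q b"
proof -
  have "coeff (p * q) (a + b) = (\<Sum>i\<le>a + b. if i = a then coeff p a * coeff q b else 0)"
    unfolding coeff_mult
  proof (intro sum.cong refl)
    fix i
    consider "i < a" | "i = a" | "a < i" by linarith
    then show "coeff p i * coeff q (a + b - i) = (if i = a then coeff p a * coeff q b else 0)"
      using assms by cases (auto simp: coeff_eq_0)
  qed
  then show ?thesis by simp
qed

lemma prod_mset_top:
  assumes "is_part mu"
    "\<And>k. 0 < k \<Longrightarrow> degree (x k) \<le> k * r" "\<And>k. 0 < k \<Longrightarrow> coeff (x k) (k * r) = psum k"
  shows "degree (\<Prod>k\<in>#mu. x k) \<le> psize mu * r
    \<and> coeff (\<Prod>k\<in>#mu. x k) (psize mu * r) = Poly_Mapping.single mu 1"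
  using assms(1)
proof (induction mu)
  case empty
  show ?case by (simp add: psize_def)
next
  case (add k mu)
  then have k: "0 < k" and IH: "degree (\<Prod>k\<in>#mu. x k) \<le> psize mu * r"
      "coeff (\<Prod>k\<in>#mu. x k) (psize mu * r) = Poly_Mapping.single mu 1"
    by (auto simp: is_part_def)
  have "degree (x k * (\<Prod>k\<in>#mu. x k)) \<le> k * r + psize mu * r"
    using degree_mult_le[of "x k" "\<Prod>k\<in>#mu. x k"] assms(2)[OF k] IH(1) by linarith
  moreover have "coeff (x k * (\<Prod>k\<in>#mu. x k)) (k * r + psize mu * r)
      = Poly_Mapping.single (add_mset k mu) 1"
    using coeff_mult_top[OF assms(2)[OF k] IH(1)] by (simp add: assms(3)[OF k] IH(2) mult_single)
  ultimately show ?case by (simp add: psize_def algebra_simps)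
qed

text \<open>If each p_k reaches t^(kr) with coefficient p_k, then p_mu with |mu| = m reaches t^(mr)
  with coefficient p_mu, and the top coefficient reproduces f. The values used are r = n - 1 for
  plethysms, r = 1 for pi_2 with its t^2 removed, and r = 0 for evaluation at X itself.\<close>

lemma sf_eval_top:
  assumes f: "homog m f"
    and x: "\<And>k. 0 < k \<Longrightarrow> degree (x k) \<le> k * r" "\<And>k. 0 < k \<Longrightarrow> coeff (x k) (k * r) = psum k"
  shows "degree (sf_eval x f) \<le> m * r" "coeff (sf_eval x f) (m * r) = sf_embed f"
proof -
  have M: "degree (\<Prod>k\<in>#mu. x k) \<le> m * r"
    "coeff (\<Prod>k\<in>#mu. x k) (m * r) = Poly_Mapping.single mu 1" if "mu \<in> parts m" for mu
    using prod_mset_top[of mu x r] x that by (auto simp: parts_def)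
  show "degree (sf_eval x f) \<le> m * r"
    unfolding sf_eval_homog[OF f]
    by (intro degree_sum_le finite_parts order_trans[OF degree_smult_le M(1)])
  have "coeff (sf_eval x f) (m * r) = (\<Sum>mu\<in>parts m. Poly_Mapping.single mu (f mu))"
    unfolding sf_eval_homog[OF f] by (simp add: coeff_sum M(2) mult_single)
  also have "\<dots> = sf_embed f"
    unfolding sf_embed_def using f
    by (intro sum.mono_neutral_right finite_parts) (auto simp: homog_def)
  finally show "coeff (sf_eval x f) (m * r) = sf_embed f" .
qed

text \<open>These are the two leading terms of the binomial expansion of (p_d + t^d)^(g+1). The pure
  power of t is split off because it is the part that can cancel between different elements of the
  cyclic group.\<close>

lemma shift_power_top:
  assumes "0 < d"
  shows "degree (shift d ^ Suc g - monom 1 (d * Suc g)) \<le> d * g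
    \<and> coeff (shift d ^ Suc g - monom 1 (d * Suc g)) (d * g) = of_nat (Suc g) * psum d"
proof (induction g)
  case 0
  show ?case by (simp add: shift_def)
next
  case (Suc g)
  let ?Y = "shift d ^ Suc g - monom 1 (d * Suc g)"
  have "shift d ^ Suc (Suc g) - monom 1 (d * Suc (Suc g))
      = shift d * ?Y + (shift d - monom 1 d) * monom 1 (d * Suc g)"
    by (simp add: algebra_simps mult_monom)
  also have "\<dots> = shift d * ?Y + monom (psum d) (d * Suc g)"
    by (simp add: shift_def smult_monom)
  finally have eq: "shift d ^ Suc (Suc g) - monom 1 (d * Suc (Suc g))
      = shift d * ?Y + monom (psum d) (d * Suc g)" .
  have s: "degree (shift d) \<le> d"
    unfolding shift_def by (intro degree_add_le) (auto simp: degree_monom_eq)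
  have c: "coeff (shift d * ?Y) (d + d * g) = coeff (shift d) d * coeff ?Y (d * g)"
    using s Suc.IH by (intro coeff_mult_top) auto
  have d: "degree (shift d * ?Y) \<le> d * Suc g"
    using degree_mult_le[of "shift d" ?Y] s Suc.IH by simp
  have "coeff (shift d) d = 1"
    using assms by (simp add: shift_def coeff_pCons split: nat.splits)
  then have "coeff (shift d * ?Y) (d * Suc g) = of_nat (Suc g) * psum d"
    using c Suc.IH by (simp only: mult_Suc_right mult_1)
  then have "coeff (shift d * ?Y + monom (psum d) (d * Suc g)) (d * Suc g) = of_nat (Suc (Suc g)) * psum d"
    by (simp only: coeff_add coeff_monom of_nat_Suc distrib_right mult_1 simp_thms if_True) (simp only: add_ac)
  moreover have "degree (shift d * ?Y + monom (psum d) (d * Suc g)) \<le> d * Suc g"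
    using d by (intro degree_add_le) (simp_all only: degree_monom_le)
  ultimately show ?case unfolding eq by blast
qed

section \<open>Plethysm with characters induced from a cyclic group\<close>

text \<open>The Frobenius characteristic of the function on C_n with value \<open>c j\<close> at the
  j-th power of the n-cycle, induced to S_n. It treats l_n and pi_n at once: omega multiplies values
  by the sign, and a permutation with gcd(j, n) cycles has sign (-1)^(n - gcd(j, n)).\<close>

definition cyc_ch :: "(nat \<Rightarrow> complex) \<Rightarrow> nat \<Rightarrow> sf" where
  "cyc_ch c n = sf_scale (1 / of_nat n)
     (sf_sum (\<lambda>j. sf_scale (c j) (sf_p (replicate_mset (gcd j n) (n div gcd j n)))) {..<n})"

lemma lie_ell_cyc: "lie_ell n = cyc_ch (\<lambda>j. cis (2 * pi / real n) ^ j) n"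
  by (simp add: lie_ell_def cyc_ch_def)

lemma replicate_mset_parts: "0 < d \<Longrightarrow> replicate_mset g d \<in> parts (g * d)"
  by (auto simp: parts_def is_part_def psize_def)

lemma cyc_type_parts:
  assumes "j < n"
  shows "replicate_mset (gcd j n) (n div gcd j n) \<in> parts n"
  using replicate_mset_parts[of "n div gcd j n" "gcd j n"] assms
  by (simp add: div_greater_zero_iff)

lemma homog_cyc_ch: "homog n (cyc_ch c n)"
  unfolding cyc_ch_def by (intro homog_scale homog_sum homog_p cyc_type_parts) simp

lemma lie_pi_cyc: "lie_pi n = cyc_ch (\<lambda>j. (-1) ^ (n - gcd j n) * cis (2 * pi / real n) ^ j) n"
proof
  fix mu
  show "lie_pi n mu = cyc_ch (\<lambda>j. (-1) ^ (n - gcd j n) * cis (2 * pi / real n) ^ j) n mu"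
    unfolding lie_pi_def lie_ell_def cyc_ch_def sf_omega_def sf_scale_def sf_sum_def sum_distrib_left
    by (intro sum.cong refl) (simp add: sf_p_def psize_def plen_def)
qed

lemma pk_pleth_p:
  assumes "0 < k"
  shows "pk_pleth k (sf_p mu) = sf_p (image_mset ((*) k) mu)"
proof
  fix nu
  have "(\<forall>x\<in>#nu. k dvd x) \<and> image_mset (\<lambda>x. x div k) nu = mu \<longleftrightarrow> nu = image_mset ((*) k) mu"
  proof safe
    assume "\<forall>x\<in>#nu. k dvd x"
    then show "nu = image_mset ((*) k) (image_mset (\<lambda>x. x div k) nu)"
      by (simp add: multiset.map_comp multiset.map_ident_strong)
  qed (use assms in \<open>auto simp: multiset.map_comp o_def\<close>)
  then show "pk_pleth k (sf_p mu) nu = sf_p (image_mset ((*) k) mu) nu"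
    by (auto simp: pk_pleth_def sf_p_def)
qed

lemma pk_pleth_scale: "pk_pleth k (sf_scale c f) = sf_scale c (pk_pleth k f)"
  by (auto simp: pk_pleth_def sf_scale_def)

lemma pk_pleth_sum: "pk_pleth k (sf_sum F A) = sf_sum (\<lambda>a. pk_pleth k (F a)) A"
proof
  fix mu
  show "pk_pleth k (sf_sum F A) mu = sf_sum (\<lambda>a. pk_pleth k (F a)) A mu"
    by (cases "\<forall>x\<in>#mu. k dvd x") (simp_all add: pk_pleth_def sf_sum_def if_not_P)
qed

text \<open>The j-th power of the n-cycle has g = gcd(j, n) cycles of length d = n/g and contributes
  (p_(kd) + t^(kd))^g. The pure powers t^(kn) collect the mean of \<open>c\<close>; what remains has
  degree at most kn - kd. Only j = 0 has d = 1, so the identity alone reaches t^(k(n-1)), with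
  coefficient n p_k, and the factor 1/n leaves p_k.\<close>

lemma sf_eval_pk_pleth_cyc:
  assumes n: "2 \<le> n" and k: "0 < k" and c: "c 0 = 1"
  obtains B where "sf_eval shift (pk_pleth k (cyc_ch c n)) = B + monom (cst ((\<Sum>j<n. c j) / of_nat n)) (k * n)"
    "degree B \<le> k * (n - 1)" "coeff B (k * (n - 1)) = psum k"
proof -
  define Y where "Y j = shift (k * (n div gcd j n)) ^ gcd j n - monom 1 (k * n)" for j
  define B where "B = smult (cst (1 / of_nat n)) (\<Sum>j<n. smult (cst (c j)) (Y j))"
  have mult: "k * (n div gcd j n) * gcd j n = k * n" for j
    by (metis dvd_div_mult_self gcd_dvd2 mult.assoc)
  have Y: "degree (Y j) \<le> k * (n div gcd j n) * (gcd j n - 1)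
      \<and> coeff (Y j) (k * (n div gcd j n) * (gcd j n - 1)) = of_nat (gcd j n) * psum (k * (n div gcd j n))" for j
  proof -
    have "gcd j n > 0" using n by simp
    then have "Suc (gcd j n - 1) = gcd j n" by simp
    moreover have "0 < k * (n div gcd j n)"
      using k n by (simp add: div_greater_zero_iff)
    ultimately show ?thesis
      using shift_power_top[of "k * (n div gcd j n)" "gcd j n - 1"] by (simp only: mult Y_def)
  qed
  have Y0: "degree (Y 0) \<le> k * (n - 1)" "coeff (Y 0) (k * (n - 1)) = of_nat n * psum k"
    using Y[of 0] n by auto
  have Yj: "degree (Y j) < k * (n - 1)" if "0 < j" "j < n" for j
  proof -
    have "n div gcd j n \<noteq> 1"
    proof
      assume "n div gcd j n = 1"
      then have "n = gcd j n" by (metis dvd_div_mult_self gcd_dvd2 mult_1)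
      then have "n dvd j" by (metis gcd_dvd1)
      with that show False using dvd_imp_le by force
    qed
    moreover have "n div gcd j n \<noteq> 0" using n by (simp add: div_eq_0_iff not_less)
    ultimately have "2 \<le> n div gcd j n" by linarith
    then have "k * 2 \<le> k * (n div gcd j n)" by simp
    then have "k < k * (n div gcd j n)" using k by linarith
    moreover have "k * (n div gcd j n) * (gcd j n - 1) = k * n - k * (n div gcd j n)"
      by (simp only: diff_mult_distrib2 mult mult_1_right)
    moreover have "k * (n div gcd j n) \<le> k * n" by simp
    moreover have "degree (Y j) \<le> k * (n div gcd j n) * (gcd j n - 1)"
      using Y by blast
    ultimately show ?thesis
      unfolding diff_mult_distrib2[of k] mult_1_right by linarith
  qed
  have "sf_eval shift (pk_pleth k (cyc_ch c n))
      = smult (cst (1 / of_nat n)) (\<Sum>j<n. smult (cst (c j)) (Y j + monom 1 (k * n)))"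
  proof -
    have 1: "pk_pleth k (cyc_ch c n) = sf_scale (1 / of_nat n)
        (sf_sum (\<lambda>j. sf_scale (c j) (sf_p (replicate_mset (gcd j n) (k * (n div gcd j n))))) {..<n})"
      by (simp add: cyc_ch_def pk_pleth_scale pk_pleth_sum pk_pleth_p[OF k])
    have 2: "homog (k * n) (sf_scale (c j) (sf_p (replicate_mset (gcd j n) (k * (n div gcd j n)))))"
      if "j < n" for j
    proof -
      have "0 < k * (n div gcd j n)" using k that by (simp add: div_greater_zero_iff)
      from replicate_mset_parts[OF this, of "gcd j n"] show ?thesis
        using mult[of j] by (intro homog_scale homog_p) (simp add: mult_ac)
    qed
    show ?thesis
      unfolding 1 sf_eval_scale
      by (subst sf_eval_sum[where n = "k * n"]) (auto simp: 2 sf_eval_scale sf_eval_p Y_def)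
  qed
  also have "\<dots> = B + monom (cst ((\<Sum>j<n. c j) / of_nat n)) (k * n)"
    by (simp add: B_def smult_add_right sum.distrib smult_monom cst_sum sum_divide_distrib
        smult_sum_right flip: monom_sum cst_mult)
      (simp add: sum_distrib_left flip: cst_mult)
  finally have 1: "sf_eval shift (pk_pleth k (cyc_ch c n)) = \<dots>" .
  have "degree (Y j) \<le> k * (n - 1)" if "j < n" for j
    using Y0 Yj[of j] that by (cases "j = 0") auto
  then have 2: "degree B \<le> k * (n - 1)"
    unfolding B_def by (intro order_trans[OF degree_smult_le] degree_sum_le) auto
  have "(\<Sum>j<n. cst (c j) * coeff (Y j) (k * (n - 1))) = (\<Sum>j<n. if j = 0 then of_nat n * psum k else 0)"
    using Y0(2) Yj by (intro sum.cong refl) (auto simp: c cst_1 coeff_eq_0)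
  then have 3: "coeff B (k * (n - 1)) = psum k"
    using n by (simp add: B_def coeff_sum mult_single flip: mult.assoc single_of_nat)
  show ?thesis using that 1 2 3 by blast
qed

lemma pleth_cyc_top:
  assumes "2 \<le> n" "c 0 = 1" "(\<Sum>j<n. c j) = 0" "homog m f"
  shows "degree (sf_eval shift (pleth f (cyc_ch c n))) \<le> m * (n - 1)"
    "coeff (sf_eval shift (pleth f (cyc_ch c n))) (m * (n - 1)) = sf_embed f"
proof -
  have "degree (sf_eval shift (pk_pleth k (cyc_ch c n))) \<le> k * (n - 1)"
    "coeff (sf_eval shift (pk_pleth k (cyc_ch c n))) (k * (n - 1)) = psum k" if k: "0 < k" for k
  proof -
    obtain B where "sf_eval shift (pk_pleth k (cyc_ch c n)) = B + monom (cst ((\<Sum>j<n. c j) / of_nat n)) (k * n)"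
      "degree B \<le> k * (n - 1)" "coeff B (k * (n - 1)) = psum k"
      using sf_eval_pk_pleth_cyc[where c = c, OF assms(1) k assms(2)] by metis
    then show "degree (sf_eval shift (pk_pleth k (cyc_ch c n))) \<le> k * (n - 1)"
      "coeff (sf_eval shift (pk_pleth k (cyc_ch c n))) (k * (n - 1)) = psum k"
      by (simp_all add: assms(3))
  qed
  with sf_eval_top[OF assms(4), of _ "n - 1"] sf_eval_pleth[OF assms(4) homog_cyc_ch]
  show "degree (sf_eval shift (pleth f (cyc_ch c n))) \<le> m * (n - 1)"
    "coeff (sf_eval shift (pleth f (cyc_ch c n))) (m * (n - 1)) = sf_embed f"
    by simp_all
qed

text \<open>The root lies in the open upper half-plane, hence is neither 1 nor -1. The sum for l_n
  needs the first, the sum for pi_n with even n the second, and the second fails at n = 2.\<close>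

lemma Im_cis_pos:
  assumes "3 \<le> n"
  shows "0 < Im (cis (2 * pi / real n))"
proof -
  have "2 * pi / real n < pi" "0 < 2 * pi / real n"
    using assms by (auto simp: field_simps)
  then show ?thesis by (simp add: sin_gt_zero)
qed

lemma sum_powers_root_of_unity:
  assumes "w ^ n = 1" "w \<noteq> (1 :: complex)"
  shows "(\<Sum>j<n. w ^ j) = 0"
  using geometric_sum[OF assms(2), of n] assms(1) by simp

lemma cis_root_of_unity: "0 < n \<Longrightarrow> cis (2 * pi / real n) ^ n = 1"
  by (simp add: DeMoivre)

lemma lie_ell_coeff_sum:
  assumes "2 \<le> n"
  shows "(\<Sum>j<n. cis (2 * pi / real n) ^ j) = 0"
proof (rule sum_powers_root_of_unity)
  show "cis (2 * pi / real n) \<noteq> 1"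
  proof (cases "n = 2")
    case False
    then show ?thesis using Im_cis_pos[of n] assms by force
  qed simp
qed (use assms in \<open>simp add: cis_root_of_unity\<close>)

text \<open>For odd n every gcd(j, n) is odd and all signs are 1. For even n the sign is (-1)^j, and
  the sum runs over the powers of the negated root, still an n-th root of unity. That one is 1
  exactly for n = 2, which is where the surviving t^2 comes from.\<close>

lemma lie_pi_coeff_sum:
  assumes "3 \<le> n"
  shows "(\<Sum>j<n. (-1) ^ (n - gcd j n) * cis (2 * pi / real n) ^ j) = 0"
proof (cases "odd n")
  case True
  have "even (n - gcd j n)" for j
    using True by (metis dvd_trans even_diff_nat gcd_dvd2 odd_add dvd_def even_mult_iff)
  then show ?thesis using lie_ell_coeff_sum[of n] assms by simp
next
  case False
  have "even (n - gcd j n) \<longleftrightarrow> even j" for j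
  proof -
    have "gcd j n \<le> n" using assms by (simp add: gcd_le2_nat)
    then have "even (n - gcd j n) \<longleftrightarrow> even (gcd j n)" using False by (simp add: even_diff_nat)
    also have "\<dots> \<longleftrightarrow> even j" using False by simp
    finally show ?thesis .
  qed
  then have "(-1 :: complex) ^ (n - gcd j n) = (-1) ^ j" for j
    by (metis neg_one_even_power neg_one_odd_power)
  then have "(-1) ^ (n - gcd j n) * cis (2 * pi / real n) ^ j = (- cis (2 * pi / real n)) ^ j" for j
    by (metis power_minus)
  moreover have "(\<Sum>j<n. (- cis (2 * pi / real n)) ^ j) = 0"
  proof (rule sum_powers_root_of_unity)
    show "- cis (2 * pi / real n) \<noteq> 1"
    proof
      assume "- cis (2 * pi / real n) = 1"
      then have "Im (- cis (2 * pi / real n)) = 0" by simp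
      with Im_cis_pos[OF assms] show False by simp
    qed
    show "(- cis (2 * pi / real n)) ^ n = 1"
      using False assms by (simp add: cis_root_of_unity)
  qed
  ultimately show ?thesis by simp
qed

section \<open>Elementary symmetric functions of a shifted alphabet\<close>

text \<open>In coefficients, k d/dp_k maps e_m to (-1)^(k-1) e_(m-k): a further part k adds k - 1 to
  size minus length.\<close>

lemma sf_e_add_mset:
  assumes "0 < k" "k \<le> m"
  shows "of_nat (k * (count nu k + 1)) * sf_e m (add_mset k nu) = (-1) ^ (k - 1) * sf_e (m - k) nu"
proof (cases "is_part nu")
  case True
  have "(of_nat (k * (count nu k + 1)) :: complex) \<noteq> 0"
    using assms by (simp only: of_nat_eq_0_iff) simp
  moreover have "psize (add_mset k nu) - plen (add_mset k nu) = (k - 1) + (psize nu - plen nu)"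
    using assms size_le_psize[OF True] by (simp add: psize_def plen_def)
  then have "(-1 :: complex) ^ (psize (add_mset k nu) - plen (add_mset k nu))
      = (-1) ^ (k - 1) * (-1) ^ (psize nu - plen nu)"
    by (simp only: power_add)
  moreover have "psize (add_mset k nu) = m \<longleftrightarrow> psize nu = m - k" "is_part (add_mset k nu)"
    using assms True by (auto simp: psize_def is_part_def)
  ultimately show ?thesis
    using assms True
    by (simp add: sf_e_def zee_add_mset del: of_nat_add of_nat_Suc)
next
  case False
  then show ?thesis by (simp add: sf_e_def is_part_def)
qed

lemma smult_cst_sign: "smult (cst ((-1) ^ j * c)) p = (-1) ^ j * smult (cst c) p"
  by (cases "even j") (simp_all add: single_uminus)

lemma smult_cst_cancel:
  assumes "smult (cst c) p = smult (cst c) q" "c \<noteq> 0"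
  shows "p = q"
proof -
  have "smult (cst (inverse c)) (smult (cst c) p) = smult (cst (inverse c)) (smult (cst c) q)"
    by (simp only: assms(1))
  with assms(2) show ?thesis by (simp add: cst_1 flip: cst_mult)
qed

lemma psize_count_superset:
  assumes "finite S" "set_mset mu \<subseteq> S"
  shows "psize mu = (\<Sum>k\<in>S. k * count mu k)"
  using assms(2)
proof (induction mu)
  case (add x mu)
  have "(\<Sum>k\<in>S. k * count (add_mset x mu) k) = (\<Sum>k\<in>S. k * count mu k + (if k = x then x else 0))"
    by (intro sum.cong) auto
  with add assms(1) show ?case by (simp add: sum.distrib psize_def)
qed (simp add: psize_def)

lemma psize_count: "psize mu = (\<Sum>k\<in>set_mset mu. k * count mu k)"
  by (rule psize_count_superset) auto

text \<open>Euler's identity m f = \<Sum> p_k (k df/dp_k) for homogeneous f of degree m, applied to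
  e_m. The degree is written as the sum of k m_k(mu), and each summand removes one part k from
  mu.\<close>

lemma newton_identity:
  "smult (cst (of_nat m)) (sf_eval x (sf_e m))
    = (\<Sum>k=1..m. (-1) ^ (k - 1) * (x k * sf_eval x (sf_e (m - k))))"
proof -
  let ?M = "\<lambda>mu. \<Prod>k\<in>#mu. x k"
  have "smult (cst (of_nat m)) (sf_eval x (sf_e m))
      = (\<Sum>mu\<in>parts m. smult (cst (of_nat (psize mu) * sf_e m mu)) (?M mu))"
    unfolding sf_eval_homog[OF homog_e] smult_sum_right by (simp add: cst_mult parts_def)
  also have "\<dots> = (\<Sum>mu\<in>parts m. \<Sum>k\<in>set_mset mu. smult (cst (of_nat (k * count mu k) * sf_e m mu)) (?M mu))"
    by (simp only: psize_count of_nat_sum sum_distrib_right cst_sum smult_sum_left)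
  also have "\<dots> = (\<Sum>(mu, k)\<in>Sigma (parts m) set_mset. smult (cst (of_nat (k * count mu k) * sf_e m mu)) (?M mu))"
    by (subst sum.Sigma) (auto simp: finite_parts)
  also have "\<dots> = (\<Sum>(k, nu)\<in>Sigma {1..m} (\<lambda>k. parts (m - k)).
      smult (cst ((-1) ^ (k - 1) * sf_e (m - k) nu)) (?M (add_mset k nu)))"
  proof (rule sum.reindex_bij_witness[where i = "\<lambda>(k, nu). (add_mset k nu, k)"
        and j = "\<lambda>(mu, k). (k, mu - {#k#})"])
    fix a assume "a \<in> Sigma (parts m) set_mset"
    then obtain mu k where a: "a = (mu, k)" and mu: "mu \<in> parts m" "k \<in># mu" by auto
    then obtain nu where nu: "mu = add_mset k nu" by (metis insert_DiffM)
    have "0 < k" using mu by (metis gr0I is_part_def mem_Collect_eq parts_def)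
    then show "(case (case a of (mu, k) \<Rightarrow> (k, mu - {#k#})) of (k, nu) \<Rightarrow> (add_mset k nu, k)) = a"
      "(case a of (mu, k) \<Rightarrow> (k, mu - {#k#})) \<in> Sigma {1..m} (\<lambda>k. parts (m - k))"
      "(case (case a of (mu, k) \<Rightarrow> (k, mu - {#k#})) of (k, nu) \<Rightarrow>
          smult (cst ((-1) ^ (k - 1) * sf_e (m - k) nu)) (?M (add_mset k nu)))
        = (case a of (mu, k) \<Rightarrow> smult (cst (of_nat (k * count mu k) * sf_e m mu)) (?M mu))"
      using mu parts_add_mset[of k nu m] sf_e_add_mset[of k m nu] by (auto simp: a nu simp del: of_nat_mult)
  qed (auto simp: parts_add_mset)
  also have "\<dots> = (\<Sum>k=1..m. (-1) ^ (k - 1) * (x k * sf_eval x (sf_e (m - k))))"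
    unfolding sf_eval_homog[OF homog_e]
    by (subst sum.Sigma[symmetric])
      (auto simp: finite_parts smult_cst_sign sum_distrib_left intro!: sum.cong)
  finally show ?thesis .
qed

lemma sf_e_0: "sf_e 0 = sf_one"
  using size_le_psize
  by (fastforce simp: sf_e_def sf_one_def fun_eq_iff is_part_def psize_def plen_def zee_empty)

lemma sf_eval_e_0: "sf_eval x (sf_e 0) = 1"
  by (simp add: sf_e_0 sf_eval_one)

text \<open>Adjoining one variable s to an alphabet with power sums x k.\<close>
lemma sf_eval_e_adjoin:
  "sf_eval (\<lambda>k. x k + s ^ k) (sf_e m)
    = sf_eval x (sf_e m) + (if m = 0 then 0 else s * sf_eval x (sf_e (m - 1)))"
proof (induction m rule: less_induct)
  case (less m)
  show ?case
  proof (cases "m = 0")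
    case True
    then show ?thesis by (simp add: sf_eval_e_0)
  next
    case False
    then obtain n where n: "m = Suc n" by (cases m) auto
    let ?E = "\<lambda>j. sf_eval x (sf_e j)"
    define F where "F j = (if j = 0 then 0 else s * ?E (j - 1))" for j
    \<comment> \<open>The terms with powers of \<open>s\<close> telescope: each is a k - a (k+1),
      with a (m+1) = 0, so only a 1 = s e_(m-1) is left. It completes the m - 1 copies of s e_(m-1)
      coming from the induction hypothesis to m copies, and m cancels.\<close>
    define a where "a k = (if k \<le> m then (-1) ^ (k - 1) * (s ^ k * ?E (m - k)) else 0)" for k
    have "smult (cst (of_nat m)) (sf_eval (\<lambda>k. x k + s ^ k) (sf_e m))
        = (\<Sum>k=1..m. (-1) ^ (k - 1) * ((x k + s ^ k) * (?E (m - k) + F (m - k))))"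
      unfolding newton_identity
      by (intro sum.cong refl) (use less.IH in \<open>auto simp: F_def\<close>)
    also have "\<dots> = (\<Sum>k=1..m. (-1) ^ (k - 1) * (x k * ?E (m - k)))
        + (\<Sum>k=1..m. (-1) ^ (k - 1) * (x k * F (m - k)))
        + (\<Sum>k=1..m. (-1) ^ (k - 1) * (s ^ k * (?E (m - k) + F (m - k))))"
      by (simp only: distrib_left distrib_right sum.distrib add_ac)
    also have "(\<Sum>k=1..m. (-1) ^ (k - 1) * (x k * ?E (m - k))) = smult (cst (of_nat m)) (?E m)"
      by (rule newton_identity[symmetric])
    also have "(\<Sum>k=1..m. (-1) ^ (k - 1) * (x k * F (m - k)))
        = (\<Sum>k=1..n. s * ((-1) ^ (k - 1) * (x k * ?E (n - k))))"
    proof -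
      have "(\<Sum>k=1..m. (-1) ^ (k - 1) * (x k * F (m - k))) = (\<Sum>k=1..n. (-1) ^ (k - 1) * (x k * F (m - k)))"
        by (simp add: n F_def)
      also have "\<dots> = (\<Sum>k=1..n. s * ((-1) ^ (k - 1) * (x k * ?E (n - k))))"
        by (intro sum.cong refl) (auto simp: n F_def Suc_diff_le mult_ac)
      finally show ?thesis .
    qed
    also have "\<dots> = s * smult (cst (of_nat n)) (?E n)"
      by (simp only: sum_distrib_left[symmetric] newton_identity)
    also have "(\<Sum>k=1..m. (-1) ^ (k - 1) * (s ^ k * (?E (m - k) + F (m - k)))) = (\<Sum>k=1..m. - (a (Suc k) - a k))"
    proof (intro sum.cong refl)
      fix k assume "k \<in> {1..m}"
      then obtain j where j: "k = Suc j" "k \<le> m" by (cases k) auto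
      then show "(-1) ^ (k - 1) * (s ^ k * (?E (m - k) + F (m - k))) = - (a (Suc k) - a k)"
        by (cases "k = m") (auto simp: a_def F_def algebra_simps)
    qed
    also have "\<dots> = s * ?E n"
      unfolding sum_negf by (subst sum_Suc_diff) (auto simp: a_def n)
    finally have "smult (cst (of_nat m)) (sf_eval (\<lambda>k. x k + s ^ k) (sf_e m))
        = smult (cst (of_nat m)) (?E m + s * ?E n)"
      by (simp add: n smult_add_right smult_add_left single_add cst_1 algebra_simps)
    then have "sf_eval (\<lambda>k. x k + s ^ k) (sf_e m) = ?E m + s * ?E n"
      by (rule smult_cst_cancel) (use False in \<open>simp only: of_nat_eq_0_iff not_False_eq_True\<close>)
    then show ?thesis by (simp add: n)
  qed
qed

lemma sf_eval_shift_e: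
  "sf_eval shift (sf_e n)
    = [:sf_embed (sf_e n):] + (if n = 0 then 0 else monom 1 1 * [:sf_embed (sf_e (n - 1)):])"
proof -
  have const: "sf_eval (\<lambda>k. [:psum k:]) (sf_e m) = [:sf_embed (sf_e m):]" for m
  proof -
    have "degree (sf_eval (\<lambda>k. [:psum k:]) (sf_e m)) \<le> 0"
      "coeff (sf_eval (\<lambda>k. [:psum k:]) (sf_e m)) 0 = sf_embed (sf_e m)"
      using sf_eval_top[OF homog_e, of "\<lambda>k. [:psum k:]" 0 m] by simp_all
    then show ?thesis by (metis degree_eq_zeroE le_zero_eq coeff_pCons_0)
  qed
  have "shift = (\<lambda>k. [:psum k:] + monom 1 1 ^ k)"
    by (simp add: shift_def monom_power fun_eq_iff)
  then show ?thesis
    using sf_eval_e_adjoin[of "\<lambda>k. [:psum k:]" "monom 1 1" n] by (simp only: const)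
qed

lemma coeff_sf_eval_shift_e:
  "coeff (sf_eval shift (sf_e n)) a
    = (if a = 0 then sf_embed (sf_e n) else if a = 1 \<and> 0 < n then sf_embed (sf_e (n - 1)) else 0)"
  unfolding sf_eval_shift_e
  by (auto simp: coeff_monom_mult coeff_pCons simp del: One_nat_def split: nat.splits)

lemma sf_pair_zero_right: "sf_pair f sf_zero = 0"
  by (simp add: sf_pair_def sf_zero_def)

lemma sf_pair_e_one: "sf_pair (sf_e n) sf_one = (if n = 0 then 1 else 0)"
proof (cases "n = 0")
  case True
  have "{mu. sf_one mu \<noteq> 0} = {{#}}" by (auto simp: sf_one_def)
  then have "sf_pair sf_one sf_one = 1" by (simp add: sf_pair_def sf_one_def zee_empty)
  then show ?thesis using True by (simp add: sf_e_0)
next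
  case False
  then have "sf_e n {#} = 0" by (simp add: sf_e_def psize_def)
  then have "sf_pair (sf_e n) sf_one = 0"
    unfolding sf_pair_def sf_one_def by (intro sum.neutral) auto
  with False show ?thesis by simp
qed

text \<open>Products of complete functions are dual to monomials, so this is the coefficient of x^js
  in e_n. It is computed by skewing with one factor at a time: h_1 turns e_n into e_(n-1), larger
  indices give 0, and negative ones make the product zero.\<close>

lemma sf_pair_e_prod_list:
  "sf_pair (sf_e n) (sf_prod_list (map sf_hz js))
    = (if set js \<subseteq> {0, 1} \<and> sum_list js = int n then 1 else 0)"
proof (induction js arbitrary: n)
  case Nil
  then show ?case by (simp add: sf_prod_list_def sf_pair_e_one)
next
  case (Cons j js)
  let ?g = "sf_prod_list (map sf_hz js)"
  have eq: "sf_prod_list (map sf_hz (j # js)) = sf_mult (sf_hz j) ?g"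
    by (simp add: sf_prod_list_def)
  have nonneg: "0 \<le> sum_list js" if "set js \<subseteq> {0, 1}"
    using that by (intro sum_list_nonneg) auto
  consider "j < 0" | "j = 0" | "j = 1" "n = 0" | "j = 1" "0 < n" | "1 < j" by linarith
  then show ?case
  proof cases
    case 1
    then have "sf_mult (sf_hz j) ?g = sf_zero"
      by (simp add: sf_hz_def sf_mult_def sf_zero_def)
    with 1 show ?thesis unfolding eq by (simp add: sf_pair_zero_right)
  next
    case 2
    then have "sf_pair (sf_e n) (sf_mult (sf_hz j) ?g) = sf_pair (sf_e n) ?g"
      using sf_pair_h_mult_embed[OF homog_e homog_e, of n 0 n] by (simp add: sf_hz_def coeff_sf_eval_shift_e)
    with 2 show ?thesis unfolding eq by (simp add: Cons.IH)
  next
    case 3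
    then have "sf_pair (sf_e n) (sf_mult (sf_hz j) ?g) = 0"
      using sf_pair_h_mult[OF homog_e, of n 1] by (simp add: sf_hz_def coeff_sf_eval_shift_e)
    with 3 nonneg show ?thesis unfolding eq by auto
  next
    case 4
    then have "sf_pair (sf_e n) (sf_mult (sf_hz j) ?g) = sf_pair (sf_e (n - 1)) ?g"
      using sf_pair_h_mult_embed[OF homog_e homog_e, of n 1 "n - 1"]
      by (simp add: sf_hz_def coeff_sf_eval_shift_e)
    with 4 show ?thesis unfolding eq by (auto simp: Cons.IH)
  next
    case 5
    then have "nat j \<noteq> 0" "nat j \<noteq> 1" by auto
    with 5 have "sf_pair (sf_e n) (sf_mult (sf_hz j) ?g) = 0"
      using sf_pair_h_mult[OF homog_e, of n "nat j"] by (simp add: sf_hz_def coeff_sf_eval_shift_e)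
    with 5 show ?thesis unfolding eq by simp
  qed
qed

section \<open>Sharpness\<close>

lemma rev_sorted_mset:
  assumes "sorted (rev xs)"
  shows "xs = rev (sorted_list_of_multiset (mset xs))"
proof -
  have "sorted_list_of_multiset (mset (rev xs)) = rev xs"
    using assms by (simp only: sorted_list_of_multiset_mset sorted_sort_id)
  then show ?thesis by (metis mset_rev rev_rev_ident)
qed

lemma sf_mult_one_right: "sf_mult f sf_one = f"
proof
  fix mu
  have "sf_mult f sf_one mu = (\<Sum>nu | nu \<subseteq># mu. if nu = mu then f nu else 0)"
    unfolding sf_mult_def sf_one_def
    by (intro sum.cong refl) (auto simp: Diff_eq_empty_iff_mset dest: subset_mset.antisym)
  then show "sf_mult f sf_one mu = f mu" by (simp add: finite_submultisets)
qed

text \<open>The transposition puts h_(m+1) into the first row, beyond the degree. The identity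
  leaves the pairing of h_m with itself, a sum of the positive numbers 1/z_mu, so no value need be
  computed.\<close>

lemma schur_coeff_rectangle:
  assumes f: "homog n f" and deg: "degree (sf_eval shift f) \<le> m"
    and top: "coeff (sf_eval shift f) m = sf_embed (sf_h m)"
  shows "schur_coeff f {#m, m#} \<noteq> 0"
proof -
  let ?xs = "[m, m]"
  have xs: "?xs = rev (sorted_list_of_multiset {#m, m#})"
    using rev_sorted_mset[of ?xs] by simp
  have other: "sf_pair f (jt_term ?xs s 0 (length ?xs)) = 0" if s: "s permutes {0..<length ?xs}" "s \<noteq> id" for s
  proof -
    have "s 0 \<noteq> 0"
    proof
      assume "s 0 = 0"
      moreover have "s 1 < 2" using permutes_in_image[OF s(1), of 1] by simp
      ultimately have "s i \<le> i" if "i \<in> {0..<length ?xs}" for i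
      proof -
        have "i = 0 \<or> i = 1" using that by auto
        with \<open>s 0 = 0\<close> \<open>s 1 < 2\<close> show ?thesis by auto
      qed
      with s show False using permutes_natset_le by blast
    qed
    then show ?thesis
      using deg by (subst jt_term_unroll) (auto intro!: sf_pair_h_mult_eq_0[OF f])
  qed
  have "schur_coeff f {#m, m#} = (\<Sum>s | s permutes {0..<length ?xs}.
      if s = id then sf_pair f (jt_term ?xs id 0 (length ?xs)) else 0)"
    unfolding schur_coeff_eq[OF xs]
  proof (intro sum.cong refl)
    fix s assume "s \<in> {s. s permutes {0..<length ?xs}}"
    then have s: "s permutes {0..<length ?xs}" by blast
    show "of_int (sign s) * sf_pair f (jt_term ?xs s 0 (length ?xs))
        = (if s = id then sf_pair f (jt_term ?xs id 0 (length ?xs)) else 0)"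
    proof (cases "s = id")
      case True
      then show ?thesis by (simp only: sign_id of_int_1 mult_1 if_True simp_thms)
    next
      case False
      then show ?thesis by (simp only: other[OF s False] if_False mult_zero_right)
    qed
  qed
  also have "\<dots> = sf_pair f (jt_term ?xs id 0 (length ?xs))"
    by (simp only: sum.delta finite_permutations finite_atLeastLessThan mem_Collect_eq permutes_id if_True)
  also have "jt_term ?xs id 0 (length ?xs) = sf_mult (sf_h m) (sf_h m)"
    by (subst jt_term_unroll) (simp_all add: sf_prod_list_def sf_hz_def sf_mult_one_right)
  also have "sf_pair f \<dots> = sf_pair (sf_h m) (sf_h m)"
    by (rule sf_pair_h_mult_embed[OF f homog_h top])
  also have "\<dots> = (\<Sum>mu\<in>parts m. complex_of_real (1 / real (zee mu)))"
    unfolding sf_pair_def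
    by (intro sum.mono_neutral_cong_left finite_parts) (auto simp: sf_h_def parts_def split: if_splits)
  also have "\<dots> = complex_of_real (\<Sum>mu\<in>parts m. 1 / real (zee mu))" by simp
  finally have eq: "schur_coeff f {#m, m#} = complex_of_real (\<Sum>mu\<in>parts m. 1 / real (zee mu))" .
  have "replicate_mset m 1 \<in> parts m" using replicate_mset_parts[of 1 m] by simp
  then have "0 < (\<Sum>mu\<in>parts m. 1 / real (zee mu))"
    by (intro sum_pos finite_parts) (auto simp: zee_pos parts_def)
  then show ?thesis unfolding eq of_real_eq_0_iff by simp
qed

text \<open>The degree forces s 0 = 0, and the first row then skews f to e_b. The remaining rows
  have indices 1 - i + s i, of which e_b admits only 0 and 1. Hence s i \<le> i for all i, and a
  permutation with this property is the identity; there all indices are 1.\<close>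

lemma schur_coeff_hook:
  assumes f: "homog n f" and deg: "degree (sf_eval shift f) \<le> a"
    and top: "coeff (sf_eval shift f) a = sf_embed (sf_e b)" and "0 < a"
  shows "schur_coeff f (add_mset a (replicate_mset b 1)) = 1"
proof -
  let ?xs = "a # replicate b 1"
  have "sorted (rev ?xs)" using \<open>0 < a\<close> by (simp add: sorted_append)
  from rev_sorted_mset[OF this] have xs: "?xs = rev (sorted_list_of_multiset (add_mset a (replicate_mset b 1)))"
    by simp
  define js where "js s = map (\<lambda>i. int (?xs ! i) - int i + int (s i)) [1..<length ?xs]" for s
  have pair: "sf_pair f (jt_term ?xs s 0 (length ?xs))
      = (if s 0 = 0 \<and> set (js s) \<subseteq> {0, 1} \<and> sum_list (js s) = int b then 1 else 0)" for s
  proof -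
    have eq: "jt_term ?xs s 0 (length ?xs) = sf_mult (sf_h (a + s 0)) (sf_prod_list (map sf_hz (js s)))"
      unfolding js_def map_map o_def by (subst jt_term_unroll) simp_all
    show ?thesis
    proof (cases "s 0 = 0")
      case True
      then show ?thesis
        unfolding eq using sf_pair_h_mult_embed[OF f homog_e top] by (simp add: sf_pair_e_prod_list)
    next
      case False
      then show ?thesis
        unfolding eq using sf_pair_h_mult_eq_0[OF f, of "a + s 0"] deg by simp
    qed
  qed
  have js: "js s = map (\<lambda>i. 1 - int i + int (s i)) [1..<Suc b]" for s
    by (auto simp: js_def nth_Cons' intro!: map_cong)
  have only_id: "s = id" if "s permutes {0..<length ?xs}" "s 0 = 0" "set (js s) \<subseteq> {0, 1}" for s
  proof -
    have "s i \<le> i" if i: "i \<in> {0..<length ?xs}" for i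
    proof (cases "i = 0")
      case True
      then show ?thesis using \<open>s 0 = 0\<close> by simp
    next
      case False
      then have "1 - int i + int (s i) \<in> set (js s)"
        using i unfolding js by (auto simp del: upt_Suc)
      then have "1 - int i + int (s i) \<in> {0, 1}"
        using \<open>set (js s) \<subseteq> {0, 1}\<close> by blast
      then show ?thesis by auto
    qed
    then show ?thesis using permutes_natset_le[OF \<open>s permutes {0..<length ?xs}\<close>] by blast
  qed
  have ids: "set (js id) \<subseteq> {0, 1}" "sum_list (js id) = int b"
    by (auto simp: js sum_list_triv)
  have "sf_pair f (jt_term ?xs s 0 (length ?xs)) = (if s = id then 1 else 0)"
    if "s permutes {0..<length ?xs}" for s
  proof (cases "s = id")
    case True
    then have "s 0 = 0 \<and> set (js s) \<subseteq> {0, 1} \<and> sum_list (js s) = int b"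
      using ids by (metis id_apply)
    then show ?thesis unfolding pair by (simp only: if_P[OF True] if_P)
  next
    case False
    then have "\<not> (s 0 = 0 \<and> set (js s) \<subseteq> {0, 1} \<and> sum_list (js s) = int b)"
      using only_id[OF that] by blast
    with False show ?thesis unfolding pair by (simp only: if_False)
  qed
  then have "schur_coeff f (add_mset a (replicate_mset b 1))
      = (\<Sum>s | s permutes {0..<length ?xs}. if s = id then 1 else 0)"
    unfolding schur_coeff_eq[OF xs] by (intro sum.cong refl) (simp add: sign_id)
  then show ?thesis by (simp add: finite_permutations permutes_id)
qed

section \<open>Leading terms and bounds of the plethysms with l_n and pi_n\<close>

lemma homog_lie_ell: "homog n (lie_ell n)" and homog_lie_pi: "homog n (lie_pi n)"
  unfolding lie_ell_cyc lie_pi_cyc by (rule homog_cyc_ch)+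

lemma pleth_lie_ell_top:
  assumes "2 \<le> n" "homog m f"
  shows "degree (sf_eval shift (pleth f (lie_ell n))) \<le> m * (n - 1)"
    "coeff (sf_eval shift (pleth f (lie_ell n))) (m * (n - 1)) = sf_embed f"
  unfolding lie_ell_cyc using assms by (intro pleth_cyc_top lie_ell_coeff_sum; simp)+

lemma pleth_lie_pi_degree:
  assumes "3 \<le> n" "homog m f"
  shows "degree (sf_eval shift (pleth f (lie_pi n))) \<le> m * (n - 1)"
  unfolding lie_pi_cyc using assms by (intro pleth_cyc_top lie_pi_coeff_sum; simp)

lemma pleth_e_lie_pi_2_top:
  assumes "1 \<le> m"
  shows "degree (sf_eval shift (pleth (sf_e m) (lie_pi 2))) \<le> m + 1"
    "coeff (sf_eval shift (pleth (sf_e m) (lie_pi 2))) (m + 1) = sf_embed (sf_e (m - 1))"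
proof -
  let ?c = "\<lambda>j. (-1) ^ (2 - gcd j 2) * cis (2 * pi / real 2) ^ j"
  \<comment> \<open>Both values are 1, since the sign of the transposition cancels cis pi = -1; thus
    t^2 keeps the coefficient 1.\<close>
  have c: "(\<Sum>j<2. ?c j) / of_nat 2 = 1"
    by (simp add: numeral_2_eq_2)
  \<comment> \<open>These are the power sums of the alphabet pi_2[X + t] with its variable t^2 taken
    out.\<close>
  define B where "B k = sf_eval shift (pk_pleth k (lie_pi 2)) - monom 1 2 ^ k" for k
  have B: "degree (B k) \<le> k * 1" "coeff (B k) (k * 1) = psum k" if k: "0 < k" for k
  proof -
    obtain C where "sf_eval shift (pk_pleth k (cyc_ch ?c 2)) = C + monom (cst ((\<Sum>j<2. ?c j) / of_nat 2)) (k * 2)"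
      "degree C \<le> k * (2 - 1)" "coeff C (k * (2 - 1)) = psum k"
      using sf_eval_pk_pleth_cyc[where n = 2 and k = k and c = ?c] k by auto
    then show "degree (B k) \<le> k * 1" "coeff (B k) (k * 1) = psum k"
      unfolding c by (simp_all add: B_def lie_pi_cyc cst_1 monom_power mult.commute)
  qed
  let ?E = "\<lambda>j. sf_eval B (sf_e j)"
  have E: "degree (?E j) \<le> j" "coeff (?E j) j = sf_embed (sf_e j)" for j
    using sf_eval_top[OF homog_e, of B 1 j] B by auto
  have "sf_eval shift (pleth (sf_e m) (lie_pi 2)) = sf_eval (\<lambda>k. B k + monom 1 2 ^ k) (sf_e m)"
    by (simp add: sf_eval_pleth[OF homog_e homog_lie_pi] B_def)
  then have eq: "sf_eval shift (pleth (sf_e m) (lie_pi 2)) = ?E m + monom 1 2 * ?E (m - 1)"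
    using assms by (simp add: sf_eval_e_adjoin)
  \<comment> \<open>The second summand has degree at most 2 + (m - 1), one more than the bound m for
    the first, so it alone determines the coefficient at t^(m+1).\<close>
  have "degree (monom 1 2 * ?E (m - 1)) \<le> 2 + (m - 1)"
    using degree_mult_le[of "monom 1 2" "?E (m - 1)"] degree_monom_le[of 1 2] E(1)[of "m - 1"]
    by (meson add_mono order_trans)
  then show "degree (sf_eval shift (pleth (sf_e m) (lie_pi 2))) \<le> m + 1"
    unfolding eq using assms E(1)[of m] by (intro degree_add_le) auto
  have "coeff (?E m) (m + 1) = 0" using E(1)[of m] by (intro coeff_eq_0) simp
  then show "coeff (sf_eval shift (pleth (sf_e m) (lie_pi 2))) (m + 1) = sf_embed (sf_e (m - 1))"
    unfolding eq using assms E(2)[of "m - 1"] by (auto simp: coeff_monom_mult)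
qed

lemma bounded_by_pleth_lie:
  assumes "3 \<le> n" "homog m f"
  shows "bounded_by (pleth f (lie_ell n)) (m * (n - 1))" "bounded_by (pleth f (lie_pi n)) (m * (n - 1))"
  by (rule bounded_by_degree[OF homog_pleth[OF assms(2) homog_lie_ell] pleth_lie_ell_top(1)];
      use assms in simp)
    (rule bounded_by_degree[OF homog_pleth[OF assms(2) homog_lie_pi] pleth_lie_pi_degree];
      use assms in simp)

lemma schur_coeff_h_lie_ell_2: "schur_coeff (pleth (sf_h m) (lie_ell 2)) {#m, m#} \<noteq> 0"
  using schur_coeff_rectangle[OF homog_pleth[OF homog_h homog_lie_ell]]
    pleth_lie_ell_top[OF _ homog_h, of 2 m] by simp

lemma schur_coeff_e_lie_pi_2:
  "1 \<le> m \<Longrightarrow> schur_coeff (pleth (sf_e m) (lie_pi 2)) (add_mset (m + 1) (replicate_mset (m - 1) 1)) = 1"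
  using pleth_e_lie_pi_2_top[of m]
  by (intro schur_coeff_hook[OF homog_pleth[OF homog_e homog_lie_pi]]) auto

lemma part1_rectangle: "part1 {#m, m#} = m"
  by (simp add: part1_def)

lemma part1_hook: "part1 (add_mset (m + 1) (replicate_mset b 1)) = m + 1"
proof -
  have "Max (insert (m + 1) (set_mset (replicate_mset b 1))) = m + 1"
    by (rule Max_eqI) (auto split: if_splits)
  then show ?thesis by (simp add: part1_def)
qed

lemma sharply_bounded_by_h_lie_ell_2:
  assumes "1 \<le> m"
  shows "sharply_bounded_by (pleth (sf_h m) (lie_ell 2)) m"
  unfolding sharply_bounded_by_def
proof safe
  show "bounded_by (pleth (sf_h m) (lie_ell 2)) m"
    using pleth_lie_ell_top(1)[OF _ homog_h, of 2 m]
    by (intro bounded_by_degree[OF homog_pleth[OF homog_h homog_lie_ell]]) simp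
  fix M assume M: "bounded_by (pleth (sf_h m) (lie_ell 2)) M"
  have "is_part {#m, m#}" using assms by (simp add: is_part_def)
  with M have "part1 {#m, m#} \<le> M"
    using schur_coeff_h_lie_ell_2[of m] unfolding bounded_by_def by simp
  then show "m \<le> M" by (simp only: part1_rectangle)
qed

lemma sharply_bounded_by_e_lie_pi_2:
  assumes "1 \<le> m"
  shows "sharply_bounded_by (pleth (sf_e m) (lie_pi 2)) (m + 1)"
  unfolding sharply_bounded_by_def
proof safe
  show "bounded_by (pleth (sf_e m) (lie_pi 2)) (m + 1)"
    using pleth_e_lie_pi_2_top[OF assms]
    by (intro bounded_by_degree[OF homog_pleth[OF homog_e homog_lie_pi]]) simp
  fix M assume M: "bounded_by (pleth (sf_e m) (lie_pi 2)) M"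
  have "is_part (add_mset (m + 1) (replicate_mset (m - 1) 1))" by (simp add: is_part_def)
  with M have "part1 (add_mset (m + 1) (replicate_mset (m - 1) 1)) \<le> M"
    using schur_coeff_e_lie_pi_2[OF assms] unfolding bounded_by_def by simp
  then show "m + 1 \<le> M" by (simp only: part1_hook)
qed

section \<open>Higher Lie characters\<close>

text \<open>\<open>sf_prod\<close> multiplies along an arbitrarily chosen enumeration; that it is
  distinct and exhausts A is all that the degree arguments use.\<close>

lemma sf_prod_obtain:
  assumes "finite A"
  obtains xs where "set xs = A" "distinct xs" "sf_prod F A = sf_prod_list (map F xs)"
proof -
  let ?xs = "SOME xs. set xs = A \<and> distinct xs"
  have "set ?xs = A \<and> distinct ?xs"
    by (rule someI_ex) (use finite_distinct_list[OF assms] in blast)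
  then show ?thesis using that[of ?xs] by (auto simp: sf_prod_def)
qed

lemma homog_sf_prod:
  assumes "finite A" "\<And>j. j \<in> A \<Longrightarrow> homog (d j) (F j)"
  shows "homog (\<Sum>j\<in>A. d j) (sf_prod F A)"
proof -
  obtain xs where "set xs = A" "distinct xs" "sf_prod F A = sf_prod_list (map F xs)"
    using sf_prod_obtain[OF assms(1)] .
  then show ?thesis
    using homog_prod_list[of xs d F] assms(2) by (simp add: sum_list_distinct_conv_sum_set)
qed

lemma sf_prod_degree:
  assumes "finite A"
    and hom: "\<And>j. j \<in> A \<Longrightarrow> homog (d j) (F j)"
    and deg: "\<And>j. j \<in> A \<Longrightarrow> degree (sf_eval shift (F j)) \<le> b j"
  shows "degree (sf_eval shift (sf_prod F A)) \<le> (\<Sum>j\<in>A. b j)"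
proof -
  obtain xs where xs: "set xs = A" "distinct xs" "sf_prod F A = sf_prod_list (map F xs)"
    using sf_prod_obtain[OF assms(1)] .
  have "sf_eval shift (sf_prod F A) = (\<Prod>y\<leftarrow>xs. sf_eval shift (F y))"
    unfolding xs(3) by (rule sf_eval_prod_list) (use hom xs in auto)
  then have "degree (sf_eval shift (sf_prod F A)) \<le> (\<Sum>y\<leftarrow>xs. degree (sf_eval shift (F y)))"
    using degree_prod_list_le[of "map (\<lambda>y. sf_eval shift (F y)) xs"] by (simp add: o_def)
  also have "\<dots> = (\<Sum>j\<in>A. degree (sf_eval shift (F j)))"
    using xs by (simp add: sum_list_distinct_conv_sum_set)
  also have "\<dots> \<le> (\<Sum>j\<in>A. b j)" by (rule sum_mono) (rule deg)
  finally show "degree (sf_eval shift (sf_prod F A)) \<le> (\<Sum>j\<in>A. b j)" .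
qed

text \<open>A block of m parts j adds m (j - 1) to the rank, which is exactly the degree bound of
  its plethysm with l_j. The bounds of the factors therefore add up to the rank.\<close>

lemma rank_count:
  assumes "is_part lam"
  shows "rank lam = (\<Sum>j\<in>set_mset lam. count lam j * (j - 1))"
proof -
  have "(\<Sum>j\<in>set_mset lam. count lam j * (j - 1)) + (\<Sum>j\<in>set_mset lam. count lam j)
      = (\<Sum>j\<in>set_mset lam. j * count lam j)"
    unfolding sum.distrib[symmetric]
  proof (intro sum.cong refl)
    fix j assume "j \<in># lam"
    then obtain i where "j = Suc i" using assms by (cases j) (auto simp: is_part_def)
    then show "count lam j * (j - 1) + count lam j = j * count lam j" by simp
  qed
  then show ?thesis
    unfolding rank_def psize_count plen_def by (simp add: size_multiset_overloaded_eq)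
qed

lemma homog_chLie: "homog (psize lam) (chLie lam)"
  and homog_chW: "homog (psize lam) (chW lam)"
proof -
  have eq: "psize lam = (\<Sum>j\<in>set_mset lam. count lam j * j)"
    by (simp add: psize_count mult.commute)
  show "homog (psize lam) (chLie lam)"
    unfolding eq chLie_def
    by (rule homog_sf_prod) (auto intro!: homog_pleth homog_h homog_lie_ell)
  show "homog (psize lam) (chW lam)"
    unfolding eq chW_def
    by (rule homog_sf_prod) (auto intro: homog_pleth homog_h homog_e homog_lie_pi)
qed

lemma bounded_by_chLie:
  assumes "is_part lam" "1 \<notin># lam"
  shows "bounded_by (chLie lam) (rank lam)"
proof (rule bounded_by_degree[OF homog_chLie])
  show "degree (sf_eval shift (chLie lam)) \<le> rank lam"
    unfolding chLie_def rank_count[OF assms(1)]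
  proof (rule sf_prod_degree[where d = "\<lambda>j. count lam j * j"])
    fix j assume "j \<in># lam"
    then have "2 \<le> j" using assms by (cases j; cases "j - 1") (auto simp: is_part_def)
    then show "degree (sf_eval shift (pleth (sf_h (count lam j)) (lie_ell j))) \<le> count lam j * (j - 1)"
      by (rule pleth_lie_ell_top[OF _ homog_h])
  qed (auto intro!: homog_pleth homog_h homog_lie_ell)
qed

lemma bounded_by_chW:
  assumes "is_part lam" "1 \<notin># lam"
  shows "bounded_by (chW lam) (rank lam + 1)"
proof (rule bounded_by_degree[OF homog_chW])
  let ?F = "\<lambda>j. if odd j then pleth (sf_h (count lam j)) (lie_pi j) else pleth (sf_e (count lam j)) (lie_pi j)"
  \<comment> \<open>The correction belongs to j = 2 alone, and the sum runs over distinct parts, so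
    it enters at most once however often 2 occurs.\<close>
  have "degree (sf_eval shift (chW lam)) \<le> (\<Sum>j\<in>set_mset lam. count lam j * (j - 1) + (if j = 2 then 1 else 0))"
    unfolding chW_def
  proof (rule sf_prod_degree[where d = "\<lambda>j. count lam j * j"])
    fix j assume j: "j \<in># lam"
    then have "2 \<le> j" using assms by (cases j; cases "j - 1") (auto simp: is_part_def)
    show "degree (sf_eval shift (?F j)) \<le> count lam j * (j - 1) + (if j = 2 then 1 else 0)"
    proof (cases "j = 2")
      case True
      then show ?thesis using pleth_e_lie_pi_2_top(1)[of "count lam j"] j by simp
    next
      case False
      with \<open>2 \<le> j\<close> have "3 \<le> j" by simp
      then show ?thesis
        using pleth_lie_pi_degree[OF _ homog_h, of j "count lam j"] pleth_lie_pi_degree[OF _ homog_e, of j "count lam j"]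
        by simp
    qed
  qed (auto intro: homog_pleth homog_h homog_e homog_lie_pi)
  also have "\<dots> \<le> rank lam + 1"
    unfolding rank_count[OF assms(1)] sum.distrib by simp
  finally show "degree (sf_eval shift (chW lam)) \<le> rank lam + 1" .
qed

section \<open>Degrees and additivity of Schur coefficients\<close>

lemma homog_prod_list_hz:
  assumes "\<forall>j\<in>set js. 0 \<le> j"
  shows "homog (nat (sum_list js)) (sf_prod_list (map sf_hz js))"
  using assms
proof (induction js)
  case (Cons j js)
  then have "homog (nat j + nat (sum_list js)) (sf_mult (sf_h (nat j)) (sf_prod_list (map sf_hz js)))"
    by (intro homog_mult homog_h) auto
  moreover have "0 \<le> sum_list js" using Cons.prems by (intro sum_list_nonneg) auto
  moreover have "sf_hz j = sf_h (nat j)" using Cons.prems by (simp add: sf_hz_def)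
  ultimately show ?case
    using Cons.prems by (simp add: sf_prod_list_def nat_add_distrib)
qed (simp add: sf_prod_list_def homog_one)

lemma prod_list_hz_zero:
  assumes "j \<in> set js" "j < 0"
  shows "sf_prod_list (map sf_hz js) = sf_zero"
  using assms
  by (induction js) (auto simp: sf_prod_list_def sf_hz_def sf_mult_def sf_zero_def)

text \<open>In every term of the determinant the row and column numbers cancel in the sum of the
  indices, because s permutes them. A negative index makes the term zero, and zero is homogeneous of
  any degree.\<close>

lemma homog_schur: "homog (psize lam) (schur lam)"
proof -
  define xs where "xs = rev (sorted_list_of_multiset lam)"
  have "mset xs = lam" by (simp add: xs_def)
  then have size: "psize lam = sum_list xs"
    unfolding psize_def by (metis sum_mset_sum_list)
  have "homog (psize lam) (jt_term xs s 0 (length xs))" if s: "s permutes {0..<length xs}" for s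
  proof -
    let ?js = "map (\<lambda>i. int (xs ! i) - int i + int (s i)) [0..<length xs]"
    have "sum_list ?js = (\<Sum>i=0..<length xs. int (xs ! i) - int i + int (s i))"
      by (simp add: sum_list_distinct_conv_sum_set)
    also have "\<dots> = (\<Sum>i=0..<length xs. int (xs ! i)) - (\<Sum>i=0..<length xs. int i)
        + (\<Sum>i=0..<length xs. int (s i))"
      by (simp add: sum.distrib sum_subtractf)
    also have "(\<Sum>i=0..<length xs. int (s i)) = (\<Sum>i=0..<length xs. int i)"
      using sum.permute[OF s, of int] by (simp add: o_def)
    finally have "nat (sum_list ?js) = psize lam"
      by (simp add: size sum_list_sum_nth flip: of_nat_sum)
    moreover have "map sf_hz ?js = map (\<lambda>i. sf_hz (int (xs ! i) - int i + int (s i))) [0..<length xs]"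
      by simp
    moreover have "homog (nat (sum_list ?js)) (sf_prod_list (map sf_hz ?js))"
    proof (cases "\<forall>j\<in>set ?js. 0 \<le> j")
      case True
      then show ?thesis by (rule homog_prod_list_hz)
    next
      case False
      then obtain j where "j \<in> set ?js" "j < 0" by (meson not_le)
      then show ?thesis by (simp only: prod_list_hz_zero homog_zero)
    qed
    ultimately show ?thesis by (simp add: o_def)
  qed
  then have "homog (psize lam) (sf_sum (\<lambda>s. sf_scale (of_int (sign s)) (jt_term xs s 0 (length xs)))
      {s. s permutes {0..<length xs}})"
    by (intro homog_sum homog_scale) auto
  then show ?thesis by (simp add: schur_def Let_def flip: xs_def)
qed

text \<open>Different degrees are orthogonal. This separates the sizes that a sum over all
  partitions of a fixed rank mixes.\<close>

lemma schur_coeff_homog: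
  assumes "homog n f" "schur_coeff f lam \<noteq> 0"
  shows "psize lam = n"
proof -
  obtain mu where "f mu \<noteq> 0" "of_nat (zee mu) * f mu * schur lam mu \<noteq> 0"
    using assms(2) unfolding schur_coeff_def by (metis (mono_tags, lifting) mem_Collect_eq sum.neutral)
  then show ?thesis
    using homogD[OF assms(1)] homogD[OF homog_schur, of lam mu] by auto
qed

text \<open>\<open>schur_coeff\<close> sums over the support of its argument, and cancellation may
  shrink the support of a sum. The union of the supports serves all terms at once.\<close>

lemma schur_coeff_sum:
  assumes "finite A" "\<And>a. a \<in> A \<Longrightarrow> homog (d a) (F a)"
  shows "schur_coeff (sf_sum F A) lam = (\<Sum>a\<in>A. schur_coeff (F a) lam)"
proof -
  let ?S = "\<Union>a\<in>A. {mu. F a mu \<noteq> 0}"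
  have fin: "finite ?S" using assms homog_finite by blast
  have "sf_sum F A mu \<noteq> 0 \<Longrightarrow> mu \<in> ?S" for mu
    unfolding sf_sum_def by (rule ccontr) simp
  then have "schur_coeff (sf_sum F A) lam = (\<Sum>mu\<in>?S. of_nat (zee mu) * sf_sum F A mu * schur lam mu)"
    unfolding schur_coeff_def using fin by (intro sum.mono_neutral_left) auto
  also have "\<dots> = (\<Sum>mu\<in>?S. \<Sum>a\<in>A. of_nat (zee mu) * F a mu * schur lam mu)"
    by (simp add: sf_sum_def sum_distrib_left sum_distrib_right)
  also have "\<dots> = (\<Sum>a\<in>A. \<Sum>mu\<in>?S. of_nat (zee mu) * F a mu * schur lam mu)"
    by (rule sum.swap)
  also have "\<dots> = (\<Sum>a\<in>A. schur_coeff (F a) lam)"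
    unfolding schur_coeff_def using fin by (intro sum.cong refl sum.mono_neutral_right) auto
  finally show ?thesis .
qed

section \<open>Sums over partitions of fixed rank without parts 1\<close>

lemma psize_eq_rank: "is_part lam \<Longrightarrow> psize lam = rank lam + size lam"
  using size_le_psize by (simp add: rank_def plen_def)

lemma size_le_rank:
  assumes "is_part lam" "1 \<notin># lam"
  shows "size lam \<le> rank lam" "size lam = rank lam \<Longrightarrow> lam = replicate_mset (rank lam) 2"
proof -
  have "2 * size lam \<le> psize lam \<and> (2 * size lam = psize lam \<longrightarrow> lam = replicate_mset (size lam) 2)"
    using assms
  proof (induction lam)
    case (add x lam)
    then have "x \<noteq> 0" "x \<noteq> 1" and IH: "2 * size lam \<le> psize lam"
        "2 * size lam = psize lam \<Longrightarrow> lam = replicate_mset (size lam) 2"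
      by (auto simp: is_part_def)
    then have "2 \<le> x" by simp
    moreover have "psize (add_mset x lam) = x + psize lam" by (simp add: psize_def)
    ultimately show ?case using IH by auto
  qed (simp add: psize_def)
  with psize_eq_rank[OF assms(1)] show "size lam \<le> rank lam"
    "size lam = rank lam \<Longrightarrow> lam = replicate_mset (rank lam) 2"
    by auto
qed

lemma finite_hat_parts: "finite (hat_parts i)"
proof (rule finite_subset)
  show "hat_parts i \<subseteq> (\<Union>n\<le>2 * i. parts n)"
    using psize_eq_rank size_le_rank(1) by (fastforce simp: hat_parts_def parts_def)
qed (simp add: finite_parts)

lemma psize_hat_parts:
  assumes "lam \<in> hat_parts i"
  shows "psize lam \<le> 2 * i" "psize lam = 2 * i \<Longrightarrow> lam = replicate_mset i 2"
  using assms psize_eq_rank[of lam] size_le_rank[of lam] by (auto simp: hat_parts_def)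

lemma replicate_2_hat_parts: "replicate_mset i 2 \<in> hat_parts i"
  by (auto simp: hat_parts_def is_part_def rank_def psize_def plen_def)

lemma schur_coeff_hat_bound:
  assumes hom: "\<And>lam. homog (psize lam) (F lam)"
    and bd: "\<And>lam. lam \<in> hat_parts i \<Longrightarrow> bounded_by (F lam) b"
    and mu: "is_part mu" "schur_coeff (sf_sum F (hat_parts i)) mu \<noteq> 0"
  shows "psize mu + part1 mu \<le> 2 * i + b"
proof -
  obtain lam where lam: "lam \<in> hat_parts i" "schur_coeff (F lam) mu \<noteq> 0"
    using mu(2) unfolding schur_coeff_sum[OF finite_hat_parts hom] by (meson sum.neutral)
  have "psize mu = psize lam" using schur_coeff_homog[OF hom lam(2)] .
  moreover have "part1 mu \<le> b" using bd[OF lam(1)] lam(2) mu(1) by (simp add: bounded_by_def)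
  ultimately show ?thesis using psize_hat_parts(1)[OF lam(1)] by linarith
qed

lemma schur_coeff_hat_top:
  assumes hom: "\<And>lam. homog (psize lam) (F lam)" and "psize mu = 2 * i"
  shows "schur_coeff (sf_sum F (hat_parts i)) mu = schur_coeff (F (replicate_mset i 2)) mu"
proof -
  have "schur_coeff (sf_sum F (hat_parts i)) mu
      = (\<Sum>lam\<in>hat_parts i. if lam = replicate_mset i 2 then schur_coeff (F lam) mu else 0)"
    unfolding schur_coeff_sum[OF finite_hat_parts hom]
    using schur_coeff_homog[OF hom, of _ mu] psize_hat_parts(2)[of _ i] assms(2)
    by (intro sum.cong refl) (metis (full_types))
  then show ?thesis by (simp add: finite_hat_parts replicate_2_hat_parts)
qed

lemma sf_prod_singleton: "sf_prod F {a} = F a"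
proof -
  obtain xs where xs: "set xs = {a}" "distinct xs" "sf_prod F {a} = sf_prod_list (map F xs)"
    using sf_prod_obtain[of "{a}" F] by auto
  from xs have "length xs = 1" by (metis distinct_card card.empty card_insert_disjoint empty_iff finite.emptyI One_nat_def)
  then obtain y where "xs = [y]" by (auto simp: length_Suc_conv)
  with xs(1) have "xs = [a]" by simp
  with xs(3) show ?thesis by (simp add: sf_prod_list_def sf_mult_one_right)
qed

lemma chLie_replicate_2: "1 \<le> i \<Longrightarrow> chLie (replicate_mset i 2) = pleth (sf_h i) (lie_ell 2)"
  and chW_replicate_2: "1 \<le> i \<Longrightarrow> chW (replicate_mset i 2) = pleth (sf_e i) (lie_pi 2)"
  by (simp_all add: chLie_def chW_def sf_prod_singleton)

theorem mainTheorem14: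
  shows "(\<forall>m n. 1 \<le> m \<and> 3 \<le> n \<longrightarrow>
            bounded_by (pleth (sf_h m) (lie_ell n)) (m * (n - 1)) \<and>
            bounded_by (pleth (sf_h m) (lie_pi n)) (m * (n - 1)) \<and>
            bounded_by (pleth (sf_e m) (lie_ell n)) (m * (n - 1)) \<and>
            bounded_by (pleth (sf_e m) (lie_pi n)) (m * (n - 1)))
       \<and> (\<forall>m. 1 \<le> m \<longrightarrow> sharply_bounded_by (pleth (sf_h m) (lie_ell 2)) m)
       \<and> (\<forall>m. 1 \<le> m \<longrightarrow> sharply_bounded_by (pleth (sf_e m) (lie_pi 2)) (m + 1))
       \<and> (\<forall>lam i. is_part lam \<and> 1 \<notin># lam \<and> rank lam = i \<longrightarrow>
            bounded_by (chLie lam) i \<and> bounded_by (chW lam) (i + 1))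
       \<and> (\<forall>i. 1 \<le> i \<longrightarrow>
            (\<forall>mu. is_part mu \<and> schur_coeff (hatLie i) mu \<noteq> 0 \<longrightarrow> psize mu + part1 mu \<le> 3 * i) \<and>
            (\<exists>mu. is_part mu \<and> schur_coeff (hatLie i) mu \<noteq> 0 \<and> psize mu + part1 mu = 3 * i) \<and>
            (\<forall>mu. is_part mu \<and> schur_coeff (hatW i) mu \<noteq> 0 \<longrightarrow> psize mu + part1 mu \<le> 3 * i + 1) \<and>
            (\<exists>mu. is_part mu \<and> schur_coeff (hatW i) mu \<noteq> 0 \<and> psize mu + part1 mu = 3 * i + 1))"
proof (intro conjI allI impI; (elim conjE)?)
  fix m n :: nat assume "1 \<le> m" "3 \<le> n"
  then show "bounded_by (pleth (sf_h m) (lie_ell n)) (m * (n - 1))"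
    "bounded_by (pleth (sf_h m) (lie_pi n)) (m * (n - 1))"
    "bounded_by (pleth (sf_e m) (lie_ell n)) (m * (n - 1))"
    "bounded_by (pleth (sf_e m) (lie_pi n)) (m * (n - 1))"
    by (auto intro: bounded_by_pleth_lie homog_h homog_e simp del: One_nat_def)
next
  fix m :: nat assume "1 \<le> m"
  then show "sharply_bounded_by (pleth (sf_h m) (lie_ell 2)) m"
    by (rule sharply_bounded_by_h_lie_ell_2)
next
  fix m :: nat assume "1 \<le> m"
  then show "sharply_bounded_by (pleth (sf_e m) (lie_pi 2)) (m + 1)"
    by (rule sharply_bounded_by_e_lie_pi_2)
next
  fix lam i assume "is_part lam" "1 \<notin># lam" "rank lam = i"
  then show "bounded_by (chLie lam) i" "bounded_by (chW lam) (i + 1)"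
    using bounded_by_chLie bounded_by_chW by blast+
next
  fix i :: nat and mu assume "is_part mu" "schur_coeff (hatLie i) mu \<noteq> 0"
  moreover have "bounded_by (chLie lam) i" if "lam \<in> hat_parts i" for lam
    using that bounded_by_chLie by (auto simp: hat_parts_def)
  ultimately have "psize mu + part1 mu \<le> 2 * i + i"
    unfolding hatLie_def by (intro schur_coeff_hat_bound[OF homog_chLie])
  then show "psize mu + part1 mu \<le> 3 * i" by simp
next
  fix i :: nat and mu assume "is_part mu" "schur_coeff (hatW i) mu \<noteq> 0"
  moreover have "bounded_by (chW lam) (i + 1)" if "lam \<in> hat_parts i" for lam
    using that bounded_by_chW by (auto simp: hat_parts_def)
  ultimately have "psize mu + part1 mu \<le> 2 * i + (i + 1)"
    unfolding hatW_def by (intro schur_coeff_hat_bound[OF homog_chW])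
  then show "psize mu + part1 mu \<le> 3 * i + 1" by simp
next
  fix i :: nat assume i: "1 \<le> i"
  \<comment> \<open>The sharp shape (i, i) of h_i[l_2] has size 2i, where only 2^i contributes; with
    its first row this gives 2i + i.\<close>
  have "psize {#i, i#} = 2 * i" by (simp add: psize_def)
  with i have "schur_coeff (hatLie i) {#i, i#} \<noteq> 0"
    unfolding hatLie_def schur_coeff_hat_top[OF homog_chLie \<open>psize {#i, i#} = 2 * i\<close>]
    by (simp add: chLie_replicate_2 schur_coeff_h_lie_ell_2)
  with i show "\<exists>mu. is_part mu \<and> schur_coeff (hatLie i) mu \<noteq> 0 \<and> psize mu + part1 mu = 3 * i"
    by (intro exI[of _ "{#i, i#}"]) (simp add: is_part_def psize_def part1_rectangle)
next
  fix i :: nat assume i: "1 \<le> i"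
  \<comment> \<open>The sharp hook of e_i[pi_2]: the i - 1 ones bring its size to 2i, and its first
    row i + 1 is the source of the extra 1.\<close>
  let ?mu = "add_mset (i + 1) (replicate_mset (i - 1) 1)"
  have size: "psize ?mu = 2 * i" using i by (simp add: psize_def)
  have "schur_coeff (hatW i) ?mu \<noteq> 0"
    unfolding hatW_def schur_coeff_hat_top[OF homog_chW size]
    using schur_coeff_e_lie_pi_2[OF i] by (simp add: chW_replicate_2[OF i])
  moreover have "is_part ?mu" by (simp add: is_part_def)
  ultimately show "\<exists>mu. is_part mu \<and> schur_coeff (hatW i) mu \<noteq> 0 \<and> psize mu + part1 mu = 3 * i + 1"
    using size part1_hook[of i "i - 1"] by (intro exI[of _ ?mu]) (simp only: simp_thms)
qed

end
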